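(* For any $N>0$, there are biPerron numbers of algebraic degree at most $6$ over $\mathbb{Q}$ whose Perron-Frobenius degrees are larger than $N$.
   Context: An algebraic integer is called a unit if the product of all its Galois conjugates is $1$ or $-1$. A (real) unit algebraic integer $\alpha>1$ is called biPerron if all other Galois conjugates of $\alpha$ lie in the annulus $\{z\in\mathbb{C} : \frac{1}{\alpha}<|z|<\alpha\}$, except possibly for $\alpha^{-1}$. In particular a biPerron number is a Perron number, where a real algebraic integer $p\geq 1$ is called Perron if it is strictly greater than the absolute value of each of its other Galois conjugates. A non-negative integral square matrix $A$ is called aperiodic if some power of $A$ has strictly positive entries. By a theorem of Lind, every Perron number is the spectral radius of some non-negative, integral, aperiodic matrix. The Perron-Frobenius degree $d_{PF}(p)$ of a Perron number $p$ is the smallest $n$ such that there is an $n\times n$ non-negative, integral, aperiodic matrix with spectral radius equal to $p$. *)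

theory Defs
  imports
    Jordan_Normal_Form.Spectral_Radius
    "HOL-Computational_Algebra.Computational_Algebra"
begin

definition min_poly_rat :: "complex \<Rightarrow> rat poly" where
  "min_poly_rat x =
    (THE p. lead_coeff p = 1 \<and> irreducible p \<and> poly (map_poly of_rat p) x = 0)"

lemma map_poly_of_rat_add:
  "map_poly (of_rat :: rat \<Rightarrow> complex) (p + q) = map_poly of_rat p + map_poly of_rat q"
  by (intro poly_eqI) (simp add: coeff_map_poly of_rat_add)

lemma map_poly_of_rat_mult:
  "map_poly (of_rat :: rat \<Rightarrow> complex) (p * q) = map_poly of_rat p * map_poly of_rat q"
  by (intro poly_eqI) (simp add: coeff_map_poly coeff_mult of_rat_sum of_rat_mult)

lemma min_poly_rat_ex1:
  fixes x :: complex
  assumes "algebraic x"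
  shows "\<exists>!p::rat poly. lead_coeff p = 1 \<and> irreducible p \<and> poly (map_poly of_rat p) x = 0"
proof -
  let ?ev = "\<lambda>p::rat poly. poly (map_poly of_rat p) x"
  have ev_dvd: "?ev q = 0" if "p dvd q" "?ev p = 0" for p q
    using that by (auto simp: dvd_def map_poly_of_rat_mult)
  obtain P :: "int poly" where P: "P \<noteq> 0" "poly (map_poly of_int P) x = 0"
    using assms by (rule algebraicE')
  define Q :: "rat poly" where "Q = map_poly of_int P"
  have Q: "Q \<noteq> 0" "?ev Q = 0"
  proof -
    show "Q \<noteq> 0" using P(1) unfolding Q_def by (auto simp: poly_eq_iff coeff_map_poly)
    have "map_poly of_rat Q = map_poly (of_int :: int \<Rightarrow> complex) P"
      unfolding Q_def by (intro poly_eqI) (simp add: coeff_map_poly)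
    then show "?ev Q = 0" using P(2) by simp
  qed
  let ?R = "\<lambda>p. p \<noteq> 0 \<and> ?ev p = 0"
  obtain p where p: "?R p" and least: "\<And>q. ?R q \<Longrightarrow> degree p \<le> degree q"
    using ex_has_least_nat[of ?R Q degree] Q by blast
  define m where "m = Polynomial.smult (inverse (lead_coeff p)) p"
  have m0: "m \<noteq> 0" and mdeg: "degree m = degree p" and mlc: "lead_coeff m = 1"
    using p unfolding m_def by auto
  have mev: "?ev m = 0"
  proof -
    have "p dvd m" unfolding m_def by (rule dvd_smult) (rule dvd_refl)
    then show ?thesis using ev_dvd p by blast
  qed
  have irr: "irreducible m"
  proof (rule irreducibleI)
    show "m \<noteq> 0" by (fact m0)
    show "\<not> m dvd 1"
    proof
      assume "m dvd 1"
      from ev_dvd[OF this mev] show False by simp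
    qed
    fix a b assume ab: "m = a * b"
    have a0: "a \<noteq> 0" and b0: "b \<noteq> 0" using ab m0 by auto
    have d: "degree m = degree a + degree b" using ab a0 b0 by (simp add: degree_mult_eq)
    have "?ev a = 0 \<or> ?ev b = 0" using mev ab by (simp add: map_poly_of_rat_mult)
    then show "a dvd 1 \<or> b dvd 1"
    proof
      assume "?ev a = 0"
      then have "degree b = 0" using least[of a] a0 d mdeg by simp
      then show ?thesis using b0 by (simp add: is_unit_iff_degree)
    next
      assume "?ev b = 0"
      then have "degree a = 0" using least[of b] b0 d mdeg by simp
      then show ?thesis using a0 by (simp add: is_unit_iff_degree)
    qed
  qed
  show ?thesis
  proof (rule ex1I[of _ m])
    show "lead_coeff m = 1 \<and> irreducible m \<and> ?ev m = 0" using mlc irr mev by blast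
    fix q assume q: "lead_coeff q = 1 \<and> irreducible q \<and> ?ev q = 0"
    have "?ev (q mod m) = ?ev (m * (q div m)) + ?ev (q mod m)"
      using ev_dvd[OF dvd_triv_left mev] by simp
    also have "\<dots> = ?ev (m * (q div m) + q mod m)"
      by (simp only: map_poly_of_rat_add poly_add)
    also have "\<dots> = 0"
      using q by (simp only: mult_div_mod_eq)
    finally have ev0: "?ev (q mod m) = 0" .
    have "q mod m = 0"
    proof (rule ccontr)
      assume nz: "q mod m \<noteq> 0"
      then have "degree p \<le> degree (q mod m)" using least ev0 by blast
      moreover have "degree (q mod m) < degree m" using degree_mod_less[OF m0, of q] nz by blast
      ultimately show False using mdeg by linarith
    qed
    then have "m dvd q" by (simp only: mod_eq_0_iff_dvd)
    then obtain c where c: "q = m * c" by (rule dvdE)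
    have "m dvd 1 \<or> c dvd 1" using irreducibleD[of q m c] c q by blast
    then have "c dvd 1" using irreducible_not_unit[OF irr] by blast
    then have "degree c = 0" by (metis is_unit_iff_degree dvd_0_left_iff one_neq_zero)
    then obtain k where k: "c = [:k:]" by (rule degree_eq_zeroE)
    have "lead_coeff q = lead_coeff m * lead_coeff c" unfolding c by (rule lead_coeff_mult)
    then have "k = 1" using q mlc k by simp
    then show "q = m" using c k by simp
  qed
qed

definition algebraic_degree :: "complex \<Rightarrow> nat" where
  "algebraic_degree x = degree (min_poly_rat x)"

definition galois_conjugates :: "complex \<Rightarrow> complex set" where
  "galois_conjugates x = {z. poly (map_poly of_rat (min_poly_rat x)) z = 0}"

text \<open>The conjugates of an algebraic number include the number itself, and they are distinct
  because an irreducible polynomial over the rationals is separable. So the product below,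
  taken over a set, is the norm.\<close>

definition unit_algebraic_int :: "complex \<Rightarrow> bool" where
  "unit_algebraic_int x \<longleftrightarrow>
    algebraic_int x \<and> (\<Prod>z\<in>galois_conjugates x. z) \<in> {1, -1}"

definition biPerron :: "real \<Rightarrow> bool" where
  "biPerron \<alpha> \<longleftrightarrow> \<alpha> > 1 \<and> unit_algebraic_int (of_real \<alpha>) \<and>
    (\<forall>z \<in> galois_conjugates (of_real \<alpha>) - {of_real \<alpha>, of_real (inverse \<alpha>)}.
      1 / \<alpha> < norm z \<and> norm z < \<alpha>)"

text \<open>The exponent is required to be positive: otherwise the zeroth power would make every
  one-by-one matrix aperiodic.\<close>

definition aperiodic_mat :: "nat \<Rightarrow> int mat \<Rightarrow> bool" where
  "aperiodic_mat n A \<longleftrightarrow> A \<in> carrier_mat n n \<and>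
    (\<forall>i<n. \<forall>j<n. A $$ (i, j) \<ge> 0) \<and>
    (\<exists>k>0. \<forall>i<n. \<forall>j<n. (A ^\<^sub>m k) $$ (i, j) > 0)"

text \<open>The condition \<open>n > 0\<close> is needed because \<^const>\<open>spectral_radius\<close> is a maximum over the
  spectrum, which is unspecified for the empty matrix. The \<open>LEAST\<close> is meaningful for Perron
  numbers, for which Lind's theorem provides some \<open>n\<close>; elsewhere its value is
  unspecified.\<close>

definition perron_frobenius_degree :: "real \<Rightarrow> nat" where
  "perron_frobenius_degree p =
    (LEAST n. n > 0 \<and>
      (\<exists>A. aperiodic_mat n A \<and> spectral_radius (map_mat of_int A) = p))"

end

theory Submission
  imports Defs "Berlekamp_Zassenhaus.Factor_Bound"
begin

text \<open>
  The lower bound comes from the geometry of eigenvectors. Let \<open>A\<close> be an aperiodic matrix of size \<open>n\<close> with spectral radius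
  \<open>q\<close>, let \<open>u\<close> be its positive eigenvector, let \<open>w\<close> be an eigenvector for another eigenvalue \<open>z\<close>,
  and put \<open>\<mu> = z / q\<close>. Conjugating \<open>A / q\<close> by the diagonal matrix of \<open>u\<close> gives a stochastic matrix
  which sends the point vector \<open>v i = w i / u i\<close> to \<open>\<mu> * v i\<close>. So the convex hull of the \<open>n\<close> points
  \<open>v i\<close> in the plane is mapped into itself by multiplication with \<open>\<mu>\<close>. If \<open>\<bar>\<mu>\<bar>\<close> is near \<open>1\<close>, the first
  \<open>n + 1\<close> points of the orbit of a farthest \<open>v i\<close> stay near the circumscribed circle, where the
  hull has points only close to its vertices; two orbit points then share a vertex, and two of
  the powers of \<open>\<mu>\<close> up to the \<open>n\<close>-th are close to each other (\<open>eigenvalue_orbit_recurrence\<close>). A Galois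
  conjugate of \<open>q\<close> is an eigenvalue of every integral matrix that has \<open>q\<close> as an eigenvalue. Hence it
  suffices that \<open>q\<close> has a conjugate \<open>z\<close> for which \<open>z / q\<close> is very near the unit circle and has no
  close returns within its first \<open>N\<close> powers.

  To produce such \<open>q\<close>, take a Gaussian rational \<open>\<mu>\<close> with these properties, near \<open>cis (2 * pi / (3 * N))\<close>, and a
  large integer \<open>K\<close> that clears denominators. The cubic \<open>(x - K) * (x - K * \<mu>) * (x - K * cnj \<mu>) = 1\<close> has
  integer coefficients, each of its roots is within \<open>1\<close> of one of \<open>K\<close>, \<open>K * \<mu>\<close>, \<open>K * cnj \<mu>\<close>, and its real root \<open>b\<close> lies
  strictly between \<open>K\<close> and \<open>K + 1\<close>, so it is irrational. The number \<open>q > 1\<close> with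
  \<open>q + 1 / q = b + 2\<close> is a root of a monic reciprocal sextic, hence a unit; the substitution
  \<open>x = z + 1 / z - 2\<close> carries the bounds on the cubic over to \<open>q\<close>, which is biPerron and has a
  conjugate within \<open>4\<close> of \<open>K * \<mu>\<close> (\<open>biPerron_of_perturbed_cubic\<close>).

  The lower bound says something about the degree only if some
  aperiodic matrix has spectral radius \<open>q\<close>. A renewal equation \<open>(\<Sum>j<n. a j / b ^ (j + 1)) = 1\<close> with positive
  integers \<open>a j\<close> makes \<open>b\<close> the Perron root of a companion matrix \<open>B\<close>, and then the block matrix with
  rows \<open>(1, 1)\<close> and \<open>(B, 1 + B)\<close> has Perron root \<open>q\<close>
  (\<open>ex_aperiodic_mat_doubled_companion\<close>). To find the \<open>a j\<close>, the unperturbed cubic, rewritten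
  for \<open>y = K / x\<close> as \<open>(1 - y) * (1 - \<mu> * y) * (1 - cnj \<mu> * y)\<close>, is multiplied by a rational polynomial so that all
  coefficients except the constant one become negative (\<open>ex_positive_renewal_multiple\<close>). This
  multiplier depends only on \<open>\<mu>\<close>; scaling back by a multiple of its denominators makes the coefficients
  integral, and the perturbation by \<open>1\<close> is negligible for large \<open>K\<close>
  (\<open>ex_renewal_coefficients\<close>).
\<close>

hide_const (open) up_ring.coeff up_ring.monom module.smult

section \<open>Perron vectors of aperiodic matrices\<close>

lemma mult_pow_mat_commute:
  fixes A :: "'a :: semiring_1 mat"
  assumes A: "A \<in> carrier_mat n n"
  shows "A * A ^\<^sub>m k = A ^\<^sub>m k * A"
proof (induction k)
  case 0
  then show ?case using A by simp
next
  case (Suc k)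
  have "A * (A ^\<^sub>m k * A) = (A * A ^\<^sub>m k) * A"
    using A by (intro assoc_mult_mat[symmetric]) auto
  then show ?case using Suc by simp
qed

lemma mult_mat_entry:
  assumes "A \<in> carrier_mat n n" "B \<in> carrier_mat n n" "i < n" "j < n"
  shows "(A * B) $$ (i, j) = (\<Sum>l<n. A $$ (i, l) * B $$ (l, j))"
  using assms by (auto simp: scalar_prod_def atLeast0LessThan intro!: sum.cong)

lemma mult_mat_vec_entry:
  assumes "A \<in> carrier_mat n n" "v \<in> carrier_vec n" "i < n"
  shows "(A *\<^sub>v v) $ i = (\<Sum>l<n. A $$ (i, l) * v $ l)"
  using assms by (auto simp: scalar_prod_def atLeast0LessThan intro!: sum.cong)

lemma eigenvalue_smult_mat:
  fixes A :: "'a :: field mat"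
  assumes A: "A \<in> carrier_mat n n" and "c \<noteq> 0" and "eigenvalue (c \<cdot>\<^sub>m A) k"
  shows "eigenvalue A (k / c)"
proof -
  obtain v where v: "v \<in> carrier_vec n" "v \<noteq> 0\<^sub>v n" "(c \<cdot>\<^sub>m A) *\<^sub>v v = k \<cdot>\<^sub>v v"
    using assms unfolding eigenvalue_def eigenvector_def by auto
  have "A *\<^sub>v v = (k / c) \<cdot>\<^sub>v v"
  proof (rule eq_vecI)
    fix i assume "i < dim_vec ((k / c) \<cdot>\<^sub>v v)"
    then have i: "i < n" using v by simp
    have "c * ((A *\<^sub>v v) $ i) = ((c \<cdot>\<^sub>m A) *\<^sub>v v) $ i"
      using A v(1) i by (simp add: scalar_prod_def sum_distrib_left mult.assoc)
    then show "(A *\<^sub>v v) $ i = ((k / c) \<cdot>\<^sub>v v) $ i"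
      using v i \<open>c \<noteq> 0\<close> by (simp add: field_simps)
  qed (use A v in auto)
  then show ?thesis unfolding eigenvalue_def eigenvector_def using A v by auto
qed

lemma pow_smult_mat_entry:
  fixes A :: "'a :: comm_semiring_1 mat"
  assumes A: "A \<in> carrier_mat n n" and "i < n" "j < n"
  shows "((c \<cdot>\<^sub>m A) ^\<^sub>m k) $$ (i, j) = c ^ k * (A ^\<^sub>m k) $$ (i, j)"
  using \<open>j < n\<close>
proof (induction k arbitrary: j)
  case 0
  then show ?case using assms by simp
next
  case (Suc k)
  have "((c \<cdot>\<^sub>m A) ^\<^sub>m Suc k) $$ (i, j) = (\<Sum>l<n. ((c \<cdot>\<^sub>m A) ^\<^sub>m k) $$ (i, l) * (c \<cdot>\<^sub>m A) $$ (l, j))"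
    unfolding pow_mat.simps using assms Suc.prems by (intro mult_mat_entry) auto
  also have "\<dots> = (\<Sum>l<n. c ^ Suc k * ((A ^\<^sub>m k) $$ (i, l) * A $$ (l, j)))"
    using Suc assms by (intro sum.cong) (auto simp: mult_ac)
  also have "\<dots> = c ^ Suc k * (A ^\<^sub>m Suc k) $$ (i, j)"
    unfolding pow_mat.simps using assms Suc.prems
    by (subst mult_mat_entry[of _ n]) (auto simp: sum_distrib_left)
  finally show ?case .
qed

text \<open>Scaling by \<open>1 / s\<close> reduces this to the boundedness of the powers of a matrix with spectral
  radius below \<open>1\<close>.\<close>

lemma pow_mat_entry_bound:
  fixes A :: "complex mat"
  assumes A: "A \<in> carrier_mat n n" and n: "n > 0" and s: "spectral_radius A < s" "s > 0"
  shows "\<exists>c. \<forall>k. \<forall>i<n. \<forall>j<n. norm ((A ^\<^sub>m k) $$ (i, j)) \<le> c * s ^ k"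
proof -
  define B where "B = of_real (1 / s) \<cdot>\<^sub>m A"
  have B: "B \<in> carrier_mat n n" using A by (simp add: B_def)
  obtain k where k: "k \<in> spectrum B" "spectral_radius B = norm k"
    using spectral_radius_mem_max(1)[OF B n] by auto
  have "eigenvalue A (k / of_real (1 / s))"
    using k(1) s unfolding spectrum_def B_def by (intro eigenvalue_smult_mat[OF A]) auto
  then have "norm (k / of_real (1 / s)) \<le> spectral_radius A"
    by (intro spectral_radius_mem_max(2)[OF A n]) (auto simp: spectrum_def)
  then have "spectral_radius B < 1"
  proof -
    have "norm k * s \<le> spectral_radius A"
      using \<open>norm (k / of_real (1 / s)) \<le> _\<close> s by (simp add: norm_mult)
    then have "norm k * s < 1 * s" using s(1) by linarith
    then have "norm k < 1" using s(2) by (simp only: mult_less_cancel_right_pos)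
    then show ?thesis using k(2) by simp
  qed
  then obtain c where c: "\<And>k. norm_bound (B ^\<^sub>m k) c"
    using spectral_radius_jnf_norm_bound_less_1_upper_triangular[OF B] by blast
  have "norm ((A ^\<^sub>m k) $$ (i, j)) \<le> c * s ^ k" if "i < n" "j < n" for i j k
  proof -
    have "norm ((B ^\<^sub>m k) $$ (i, j)) \<le> c"
      using c[of k] that B unfolding norm_bound_def by auto
    then show ?thesis using s that A unfolding B_def
      by (subst (asm) pow_smult_mat_entry[OF A]) (auto simp: norm_mult norm_power norm_divide field_simps)
  qed
  then show ?thesis by blast
qed

lemma pow_mat_nonneg:
  fixes A :: "int mat"
  assumes A: "A \<in> carrier_mat n n" and nn: "\<And>i j. i < n \<Longrightarrow> j < n \<Longrightarrow> A $$ (i, j) \<ge> 0" and "i < n" "j < n"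
  shows "(A ^\<^sub>m k) $$ (i, j) \<ge> 0"
  using \<open>j < n\<close>
proof (induction k arbitrary: j)
  case 0
  then show ?case using assms by simp
next
  case (Suc k)
  then show ?case unfolding pow_mat.simps using assms
    by (subst mult_mat_entry[of _ n]) (auto intro!: sum_nonneg)
qed

text \<open>The truncated Neumann series \<open>u = (\<Sum>k<m. 1 A\<^sup>k / s\<^sup>k)\<close>, applied to the all-ones row, satisfies
  \<open>u A = s (u - 1 + 1 A\<^sup>m / s\<^sup>m)\<close>. The powers of \<open>A / s\<close> tend to \<open>0\<close>, so the remainder is at most the
  all-ones row once \<open>m\<close> is large.\<close>

lemma left_subinvariant_vector:
  fixes A :: "int mat"
  assumes A: "A \<in> carrier_mat n n" and n: "n > 0"
    and nn: "\<And>i j. i < n \<Longrightarrow> j < n \<Longrightarrow> A $$ (i, j) \<ge> 0"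
    and s: "spectral_radius (map_mat of_int A) < s" "s > 0"
  shows "\<exists>u :: nat \<Rightarrow> real. \<forall>j<n. u j > 0 \<and> (\<Sum>i<n. u i * of_int (A $$ (i, j))) \<le> s * u j"
proof -
  \<comment> \<open>the series is compared with a geometric one at a rate \<open>r\<close> strictly between the spectral radius and \<open>s\<close>\<close>
  define r where "r = max (s / 2) ((spectral_radius (map_mat of_int A) + s) / 2)"
  have r: "spectral_radius (map_mat of_int A) < r" "0 < r" "r < s"
    using s by (auto simp: r_def less_max_iff_disj)
  have Ac: "map_mat of_int A \<in> carrier_mat n n" using A by simp
  obtain c where c: "\<And>k i j. i < n \<Longrightarrow> j < n \<Longrightarrow>
      norm ((map_mat of_int A ^\<^sub>m k) $$ (i, j) :: complex) \<le> c * r ^ k"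
    using pow_mat_entry_bound[OF Ac n r(1,2)] by blast
  have pow: "map_mat of_int A ^\<^sub>m k = (map_mat of_int (A ^\<^sub>m k) :: complex mat)" for k
    using of_int_hom.mat_hom_pow[OF A] by metis
  have c': "of_int ((A ^\<^sub>m k) $$ (i, j)) \<le> c * r ^ k" if "i < n" "j < n" for k i j
  proof -
    have "norm (complex_of_int ((A ^\<^sub>m k) $$ (i, j))) \<le> c * r ^ k"
      using c[OF that, of k] that A unfolding pow by simp
    then show ?thesis by simp
  qed
  define y where "y k j = real_of_int (\<Sum>i<n. (A ^\<^sub>m k) $$ (i, j))" for k j
  have y_nn: "y k j \<ge> 0" if "j < n" for k j
    unfolding y_def of_int_sum using pow_mat_nonneg[OF A nn _ that]
    by (intro sum_nonneg) auto
  have y_0: "y 0 j = 1" if "j < n" for j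
    using that A by (simp add: y_def)
  have y_Suc: "(\<Sum>i<n. y k i * of_int (A $$ (i, j))) = y (Suc k) j" if "j < n" for k j
  proof -
    have "(\<Sum>i<n. (A ^\<^sub>m Suc k) $$ (i, j)) = (\<Sum>i<n. \<Sum>l<n. (A ^\<^sub>m k) $$ (i, l) * A $$ (l, j))"
      unfolding pow_mat.simps using A that by (intro sum.cong refl mult_mat_entry) auto
    also have "\<dots> = (\<Sum>l<n. (\<Sum>i<n. (A ^\<^sub>m k) $$ (i, l)) * A $$ (l, j))"
      by (subst sum.swap) (simp add: sum_distrib_right)
    finally show ?thesis by (simp add: y_def)
  qed
  have "(\<lambda>k. real n * c * (r / s) ^ k) \<longlonglongrightarrow> real n * c * 0"
    using r by (intro tendsto_mult tendsto_const LIMSEQ_power_zero) auto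
  then have "eventually (\<lambda>k. real n * c * (r / s) ^ k < 1) sequentially"
    by (intro order_tendstoD) auto
  then obtain m0 where m0: "\<And>k. k \<ge> m0 \<Longrightarrow> real n * c * (r / s) ^ k < 1"
    by (auto simp: eventually_sequentially)
  define m where "m = Suc m0"
  have y_m: "y m j / s ^ m \<le> 1" if "j < n" for j
  proof -
    have "y m j \<le> (\<Sum>i<n. c * r ^ m)"
      unfolding y_def of_int_sum by (intro sum_mono c') (use that in auto)
    also have "\<dots> = real n * c * (r / s) ^ m * s ^ m" using s by (simp add: power_divide)
    also have "\<dots> \<le> 1 * s ^ m" using m0[of m] s by (intro mult_right_mono) (auto simp: m_def)
    finally show ?thesis using s by (simp add: field_simps)
  qed
  define u where "u j = (\<Sum>k<m. y k j / s ^ k)" for j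
  have "u j > 0" if "j < n" for j
  proof -
    have "u j = y 0 j + (\<Sum>k<m0. y (Suc k) j / s ^ Suc k)"
      unfolding u_def m_def sum.lessThan_Suc_shift by simp
    moreover have "(\<Sum>k<m0. y (Suc k) j / s ^ Suc k) \<ge> 0"
      using y_nn[OF that] s by (intro sum_nonneg) auto
    ultimately show ?thesis using y_0[OF that] by linarith
  qed
  moreover have "(\<Sum>i<n. u i * of_int (A $$ (i, j))) \<le> s * u j" if "j < n" for j
  proof -
    have "(\<Sum>i<n. u i * of_int (A $$ (i, j))) = (\<Sum>k<m. (\<Sum>i<n. y k i * of_int (A $$ (i, j))) / s ^ k)"
      unfolding u_def sum_distrib_right sum_divide_distrib by (subst sum.swap) simp
    also have "\<dots> = (\<Sum>k<m. s * (y (Suc k) j / s ^ Suc k))"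
      using s by (intro sum.cong) (auto simp: y_Suc[OF that])
    also have "\<dots> = s * (\<Sum>k<m. y (Suc k) j / s ^ Suc k)" by (simp add: sum_distrib_left)
    also have "(\<Sum>k<m. y (Suc k) j / s ^ Suc k) = (\<Sum>k<Suc m. y k j / s ^ k) - y 0 j"
      unfolding sum.lessThan_Suc_shift by simp
    also have "\<dots> = u j + y m j / s ^ m - 1" by (simp add: u_def y_0[OF that])
    also have "s * \<dots> \<le> s * u j" using y_m[OF that] s by (intro mult_left_mono) auto
    finally show ?thesis .
  qed
  ultimately show ?thesis by blast
qed

lemma eigenvalue_of_positive_vector:
  fixes A :: "int mat" and x :: "nat \<Rightarrow> real"
  assumes A: "A \<in> carrier_mat n n" and n: "n > 0"
    and x: "\<And>i. i < n \<Longrightarrow> x i > 0"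
    and eq: "\<And>i. i < n \<Longrightarrow> (\<Sum>j<n. of_int (A $$ (i, j)) * x j) = s * x i"
  shows "eigenvalue (map_mat of_int A) (complex_of_real s)"
proof -
  have Ac: "map_mat of_int A \<in> carrier_mat n n" using A by simp
  define v where "v = vec n (\<lambda>i. complex_of_real (x i))"
  have "map_mat of_int A *\<^sub>v v = of_real s \<cdot>\<^sub>v v"
  proof (rule eq_vecI)
    fix i assume "i < dim_vec (of_real s \<cdot>\<^sub>v v)"
    then have i: "i < n" by (simp add: v_def)
    have "(map_mat of_int A *\<^sub>v v) $ i = (\<Sum>j<n. of_int (A $$ (i, j)) * complex_of_real (x j))"
      using i A by (subst mult_mat_vec_entry[OF Ac]) (auto simp: v_def)
    also have "\<dots> = of_real (\<Sum>j<n. of_int (A $$ (i, j)) * x j)" by simp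
    finally show "(map_mat of_int A *\<^sub>v v) $ i = (of_real s \<cdot>\<^sub>v v) $ i"
      using i eq by (simp add: v_def)
  qed (use Ac in \<open>auto simp: v_def\<close>)
  moreover have "v \<noteq> 0\<^sub>v n"
  proof
    assume "v = 0\<^sub>v n"
    then have "v $ 0 = 0" using n by simp
    then show False using x[OF n] n by (simp add: v_def)
  qed
  ultimately show ?thesis unfolding eigenvalue_def eigenvector_def
    using A by (intro exI[of _ v]) (auto simp: v_def)
qed

text \<open>The absolute values \<open>x\<close> of an eigenvector for an eigenvalue of maximal modulus satisfy
  \<open>A x \<ge> s x\<close>. A strict inequality in some coordinate would be spread to all coordinates by
  the positive power \<open>P = A\<^sup>k\<close>, giving a positive \<open>y = P x\<close> with \<open>A y \<ge> t y\<close> for some \<open>t > s\<close>. Pairing \<open>y\<close> with a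
  left subinvariant vector for a value between \<open>s\<close> and \<open>t\<close> excludes this. Hence equality holds
  everywhere, and \<open>y\<close> is the positive eigenvector.\<close>

lemma perron_frobenius_eigenvector:
  assumes A: "aperiodic_mat n A" and n: "n > 0"
  defines "s \<equiv> spectral_radius (map_mat of_int A)"
  shows "\<exists>x :: nat \<Rightarrow> real. \<forall>i<n. x i > 0 \<and> (\<Sum>j<n. of_int (A $$ (i, j)) * x j) = s * x i"
proof -
  have A_carrier: "A \<in> carrier_mat n n" and nn: "\<And>i j. i < n \<Longrightarrow> j < n \<Longrightarrow> A $$ (i, j) \<ge> 0"
    using A by (auto simp: aperiodic_mat_def)
  obtain k where k: "\<And>i j. i < n \<Longrightarrow> j < n \<Longrightarrow> (A ^\<^sub>m k) $$ (i, j) > 0"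
    using A unfolding aperiodic_mat_def by blast
  define a where "a i j = real_of_int (A $$ (i, j))" for i j
  define P where "P i j = real_of_int ((A ^\<^sub>m k) $$ (i, j))" for i j
  have P_pos: "P i j > 0" if "i < n" "j < n" for i j using k that by (simp add: P_def)
  have a_nn: "a i j \<ge> 0" if "i < n" "j < n" for i j using nn that by (simp add: a_def)
  have comm: "(\<Sum>l<n. a i l * P l j) = (\<Sum>l<n. P i l * a l j)" if "i < n" "j < n" for i j
  proof -
    have "(\<Sum>l<n. A $$ (i, l) * (A ^\<^sub>m k) $$ (l, j)) = (A * A ^\<^sub>m k) $$ (i, j)"
      using A_carrier that by (intro mult_mat_entry[symmetric]) auto
    also have "\<dots> = (A ^\<^sub>m k * A) $$ (i, j)"
      by (simp add: mult_pow_mat_commute[OF A_carrier])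
    also have "\<dots> = (\<Sum>l<n. (A ^\<^sub>m k) $$ (i, l) * A $$ (l, j))"
      using A_carrier that by (intro mult_mat_entry) auto
    finally show ?thesis unfolding a_def P_def
      by (metis (mono_tags, lifting) of_int_mult of_int_sum sum.cong)
  qed
  have comm_vec: "(\<Sum>j<n. a i j * (\<Sum>l<n. P j l * x l)) = (\<Sum>j<n. P i j * (\<Sum>l<n. a j l * x l))"
    if "i < n" for i x
  proof -
    have "(\<Sum>j<n. a i j * (\<Sum>l<n. P j l * x l)) = (\<Sum>l<n. (\<Sum>j<n. a i j * P j l) * x l)"
      unfolding sum_distrib_left sum_distrib_right by (subst sum.swap) (simp add: mult_ac)
    also have "\<dots> = (\<Sum>l<n. (\<Sum>j<n. P i j * a j l) * x l)"
      using comm that by simp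
    also have "\<dots> = (\<Sum>j<n. P i j * (\<Sum>l<n. a j l * x l))"
      unfolding sum_distrib_left sum_distrib_right by (subst sum.swap) (simp add: mult_ac)
    finally show ?thesis .
  qed
  have Ac: "map_mat of_int A \<in> carrier_mat n n" using A_carrier by simp
  obtain \<nu> :: complex where \<nu>: "\<nu> \<in> spectrum (map_mat of_int A)" "norm \<nu> = s"
    using spectral_radius_mem_max(1)[OF Ac n] unfolding s_def by auto
  obtain w where w: "w \<in> carrier_vec n" "w \<noteq> 0\<^sub>v n" "map_mat of_int A *\<^sub>v w = \<nu> \<cdot>\<^sub>v w"
    using \<nu>(1) A_carrier unfolding spectrum_def eigenvalue_def eigenvector_def by auto
  have w_eq: "(\<Sum>j<n. of_real (a i j) * w $ j) = \<nu> * w $ i" if "i < n" for i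
  proof -
    have "(map_mat of_int A *\<^sub>v w) $ i = (\<Sum>j<n. of_real (a i j) * w $ j)"
      using that A_carrier w(1) by (subst mult_mat_vec_entry[OF Ac]) (auto simp: a_def)
    then show ?thesis using w that by simp
  qed
  have s0: "s \<ge> 0" using \<nu>(2) norm_ge_zero[of \<nu>] by simp
  define x where "x i = norm (w $ i)" for i
  have x_nn: "x i \<ge> 0" for i by (simp add: x_def)
  obtain i1 where i1: "i1 < n" "x i1 > 0" using w(1,2) by (force simp: x_def vec_eq_iff)
  have x_sup: "s * x i \<le> (\<Sum>j<n. a i j * x j)" if "i < n" for i
  proof -
    have "s * x i = norm (\<Sum>j<n. of_real (a i j) * w $ j)"
      using w_eq[OF that] \<nu>(2) by (simp add: norm_mult x_def)
    also have "\<dots> \<le> (\<Sum>j<n. norm (of_real (a i j) * w $ j))" by (rule norm_sum)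
    also have "\<dots> = (\<Sum>j<n. a i j * x j)"
      using a_nn that by (intro sum.cong) (auto simp: norm_mult x_def)
    finally show ?thesis .
  qed
  define y where "y i = (\<Sum>j<n. P i j * x j)" for i
  have P_vec_pos: "(\<Sum>j<n. P i j * v j) > 0" if "i < n" "j0 < n" "v j0 > 0" "\<And>j. j < n \<Longrightarrow> v j \<ge> 0" for i j0 v
    using that P_pos by (intro sum_pos2[of _ j0]) (auto simp: less_imp_le)
  have y_pos: "y i > 0" if "i < n" for i
    unfolding y_def using P_vec_pos[of i i1 x] that i1 x_nn by simp
  have eq: "(\<Sum>j<n. a i j * x j) = s * x i" if "i < n" for i
  proof (rule ccontr)
    assume ne: "(\<Sum>j<n. a i j * x j) \<noteq> s * x i"
    define e where "e i = (\<Sum>j<n. a i j * x j) - s * x i" for i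
    have e: "e i > 0" "\<And>j. j < n \<Longrightarrow> e j \<ge> 0" using ne x_sup that by (force simp: e_def)+
    have strict: "(\<Sum>j<n. a l j * y j) > s * y l" if "l < n" for l
    proof -
      have "(\<Sum>j<n. a l j * y j) - s * y l = (\<Sum>j<n. P l j * e j)"
        using comm_vec[OF that, of x]
        by (simp add: y_def e_def right_diff_distrib sum_subtractf sum_distrib_left mult_ac)
      moreover have "(\<Sum>j<n. P l j * e j) > 0"
        using P_vec_pos[of l i e] that \<open>i < n\<close> e by blast
      ultimately show ?thesis by simp
    qed
    define t where "t = Min ((\<lambda>l. (\<Sum>j<n. a l j * y j) / y l) ` {..<n})"
    have "t \<in> (\<lambda>l. (\<Sum>j<n. a l j * y j) / y l) ` {..<n}"
      unfolding t_def using n by (intro Min_in) auto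
    then have t: "t > s" using strict y_pos by (auto simp: field_simps)
    have t_le: "t * y l \<le> (\<Sum>j<n. a l j * y j)" if "l < n" for l
    proof -
      have "t \<le> (\<Sum>j<n. a l j * y j) / y l" unfolding t_def using that by (intro Min_le) auto
      then show ?thesis using y_pos[OF that] by (simp add: field_simps)
    qed
    define r where "r = (s + t) / 2"
    have r: "s < r" "r < t" "r > 0" using t s0 by (auto simp: r_def)
    obtain u where u: "\<And>j. j < n \<Longrightarrow> u j > (0::real)"
      "\<And>j. j < n \<Longrightarrow> (\<Sum>i<n. u i * a i j) \<le> r * u j"
      using left_subinvariant_vector[OF A_carrier n nn, of r] r unfolding s_def a_def by blast
    have "t * (\<Sum>l<n. u l * y l) = (\<Sum>l<n. u l * (t * y l))"
      by (simp add: sum_distrib_left mult_ac)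
    also have "\<dots> \<le> (\<Sum>l<n. u l * (\<Sum>j<n. a l j * y j))"
      using u t_le by (intro sum_mono mult_left_mono) (auto simp: less_imp_le)
    also have "\<dots> = (\<Sum>j<n. (\<Sum>l<n. u l * a l j) * y j)"
      unfolding sum_distrib_left sum_distrib_right by (subst sum.swap) (simp add: mult_ac)
    also have "\<dots> \<le> (\<Sum>j<n. (r * u j) * y j)"
      using u y_pos by (intro sum_mono mult_right_mono) (auto simp: less_imp_le)
    also have "\<dots> = r * (\<Sum>l<n. u l * y l)" by (simp add: sum_distrib_left mult_ac)
    finally have "t * (\<Sum>l<n. u l * y l) \<le> r * (\<Sum>l<n. u l * y l)" .
    moreover have "(\<Sum>l<n. u l * y l) > 0"
      using n u y_pos by (intro sum_pos) auto
    ultimately show False using r by simp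
  qed
  have y_eq: "(\<Sum>j<n. a i j * y j) = s * y i" if "i < n" for i
  proof -
    have "(\<Sum>j<n. a i j * y j) = (\<Sum>j<n. P i j * (s * x j))"
      unfolding y_def comm_vec[OF that] by (intro sum.cong) (auto simp: eq)
    then show ?thesis by (simp add: y_def sum_distrib_left mult_ac)
  qed
  show ?thesis using y_pos y_eq unfolding a_def by blast
qed

lemma spectral_radius_eigenvalue:
  assumes A: "aperiodic_mat n A" and n: "n > 0"
  shows "eigenvalue (map_mat of_int A) (complex_of_real (spectral_radius (map_mat of_int A)))"
proof -
  have "A \<in> carrier_mat n n" using A by (simp add: aperiodic_mat_def)
  then show ?thesis
    using perron_frobenius_eigenvector[OF A n] eigenvalue_of_positive_vector[OF _ n] by blast
qed

section \<open>Close returns of eigenvalue ratios\<close>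

text \<open>The convex hull of the points \<open>w i / u i\<close> is described by the half planes containing it. Each of
  them contains the images of these points under the powers of \<open>z / q\<close>, because \<open>A / q\<close>
  averages the points with weights \<open>a i j * u j / (q * u i)\<close>. In this form no convex combination has to
  be carried through the induction.\<close>

lemma half_plane_invariant:
  fixes a :: "nat \<Rightarrow> nat \<Rightarrow> real" and u :: "nat \<Rightarrow> real" and w :: "nat \<Rightarrow> complex"
  assumes nonneg: "\<And>i j. i < n \<Longrightarrow> j < n \<Longrightarrow> a i j \<ge> 0" and q: "q > 0"
    and u: "\<And>i. i < n \<Longrightarrow> (\<Sum>j<n. a i j * u j) = q * u i"
    and w: "\<And>i. i < n \<Longrightarrow> (\<Sum>j<n. of_real (a i j) * w j) = z * w i"
    and half: "\<And>i. i < n \<Longrightarrow> Re (c * w i) \<le> d * u i"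
    and "i < n"
  shows "Re (c * (z / of_real q) ^ k * w i) \<le> d * u i"
  using half \<open>i < n\<close>
proof (induction k arbitrary: c i)
  case 0
  then show ?case by simp
next
  case (Suc k)
  have step: "Re (c * (z / of_real q) * w l) \<le> d * u l" if "l < n" for l
  proof -
    have "Re (c * (z / of_real q) * w l) = Re (c * (z * w l) / of_real q)"
      by (simp add: field_simps)
    also have "\<dots> = Re (c * (\<Sum>j<n. of_real (a l j) * w j)) / q"
      by (simp only: w[OF that] Re_divide_of_real)
    also have "Re (c * (\<Sum>j<n. of_real (a l j) * w j)) = (\<Sum>j<n. a l j * Re (c * w j))"
      by (simp add: sum_distrib_left Re_sum algebra_simps)
    also have "(\<Sum>j<n. a l j * Re (c * w j)) \<le> (\<Sum>j<n. a l j * (d * u j))"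
      by (intro sum_mono mult_left_mono) (use Suc.prems nonneg that in auto)
    also have "\<dots> = d * (q * u l)"
      by (simp add: u[OF that, symmetric] sum_distrib_left algebra_simps)
    finally show ?thesis using q by (simp add: divide_right_mono)
  qed
  have "Re (c * (z / of_real q) * (z / of_real q) ^ k * w i) \<le> d * u i"
    by (rule Suc.IH) (use step Suc.prems in auto)
  then show ?case by (simp add: mult.assoc)
qed

text \<open>A point \<open>p\<close> of the hull is separated from it by no half plane, so some vertex \<open>v i\<close> reaches as far
  as \<open>p\<close> in the direction of \<open>p\<close>. As \<open>v i\<close> lies in the disk of radius \<open>R\<close>, expanding
  the square of \<open>\<bar>v i - p\<bar>\<close> bounds it by \<open>R\<^sup>2 - \<bar>p\<bar>\<^sup>2\<close>.\<close>

lemma orbit_close_to_vertex: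
  fixes v :: "nat \<Rightarrow> complex"
  assumes "n > 0"
    and inv: "\<And>c d i. (\<And>i. i < n \<Longrightarrow> Re (c * v i) \<le> d) \<Longrightarrow> i < n \<Longrightarrow> Re (c * m * v i) \<le> d"
    and i0: "i0 < n" and R: "\<And>i. i < n \<Longrightarrow> norm (v i) \<le> R"
  shows "\<exists>i<n. (norm (v i - m * v i0))\<^sup>2 \<le> R\<^sup>2 - (norm (m * v i0))\<^sup>2"
proof -
  define p where "p = m * v i0"
  have "\<exists>i<n. Re (cnj p * v i) \<ge> (norm p)\<^sup>2"
  proof (rule ccontr)
    assume "\<not> ?thesis"
    then have less: "Re (cnj p * v i) < (norm p)\<^sup>2" if "i < n" for i using that by force
    \<comment> \<open>the half plane \<open>Re (cnj p * x) \<le> d\<close> contains all vertices, but not \<open>p\<close>\<close>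
    define d where "d = Max ((\<lambda>i. Re (cnj p * v i)) ` {..<n})"
    have "d \<in> (\<lambda>i. Re (cnj p * v i)) ` {..<n}"
      unfolding d_def using \<open>n > 0\<close> by (intro Max_in) auto
    then have "d < (norm p)\<^sup>2" using less by auto
    moreover have "Re (cnj p * m * v i0) \<le> d"
      by (rule inv[OF _ i0]) (auto simp: d_def intro!: Max_ge)
    moreover have "Re (cnj p * m * v i0) = (norm p)\<^sup>2"
      by (metis Re_complex_of_real complex_norm_square mult.assoc mult.commute p_def)
    ultimately show False by simp
  qed
  then obtain i where i: "i < n" "Re (cnj p * v i) \<ge> (norm p)\<^sup>2" by blast
  have "(norm (v i - p))\<^sup>2 = (norm (v i))\<^sup>2 - 2 * Re (cnj p * v i) + (norm p)\<^sup>2"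
    unfolding cmod_power2 by (simp add: power2_eq_square algebra_simps)
  also have "\<dots> \<le> R\<^sup>2 - (norm p)\<^sup>2"
    using i power_mono[OF R[OF i(1)], of 2] by simp
  finally show ?thesis using i(1) unfolding p_def by blast
qed

text \<open>The orbit starts at a vertex of maximal modulus \<open>R\<close>. By \<open>orbit_close_to_vertex\<close> each of its first
  \<open>n + 1\<close> points is within \<open>R * sqrt (1 - \<bar>\<mu>\<bar> ^ (2 * n))\<close> of one of the \<open>n\<close> vertices, so two of them are
  assigned the same vertex.\<close>

lemma eigenvalue_orbit_recurrence:
  fixes a :: "nat \<Rightarrow> nat \<Rightarrow> real" and u :: "nat \<Rightarrow> real" and w :: "nat \<Rightarrow> complex"
  assumes nonneg: "\<And>i j. i < n \<Longrightarrow> j < n \<Longrightarrow> a i j \<ge> 0" and q: "q > 0"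
    and u_pos: "\<And>i. i < n \<Longrightarrow> u i > 0"
    and u: "\<And>i. i < n \<Longrightarrow> (\<Sum>j<n. a i j * u j) = q * u i"
    and w: "\<And>i. i < n \<Longrightarrow> (\<Sum>j<n. of_real (a i j) * w j) = z * w i"
    and w_nz: "\<exists>i<n. w i \<noteq> 0" and z: "norm z \<le> q"
  defines "\<mu> \<equiv> z / of_real q"
  shows "\<exists>k k'. k < k' \<and> k' \<le> n \<and> norm (\<mu> ^ k - \<mu> ^ k') \<le> 2 * sqrt (1 - norm \<mu> ^ (2 * n))"
proof -
  define v where "v i = w i / of_real (u i)" for i
  have n: "n > 0" using w_nz by auto
  have w_v: "w i = of_real (u i) * v i" if "i < n" for i
    using u_pos[OF that] by (simp add: v_def)
  have scale: "Re (c * w i) = u i * Re (c * v i)" if "i < n" for c i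
    by (simp add: w_v[OF that] algebra_simps)
  have inv: "Re (c * \<mu> ^ k * v i) \<le> d"
    if "\<And>i. i < n \<Longrightarrow> Re (c * v i) \<le> d" "i < n" for c d i k
  proof -
    have "Re (c * \<mu> ^ k * w i) \<le> d * u i"
      unfolding \<mu>_def
    proof (rule half_plane_invariant[OF nonneg q u w _ \<open>i < n\<close>])
      show "Re (c * w i) \<le> d * u i" if "i < n" for i
        using that \<open>\<And>i. i < n \<Longrightarrow> Re (c * v i) \<le> d\<close>[OF that] u_pos[OF that] scale[OF that, of c]
        by (simp add: mult.commute)
    qed
    then show ?thesis using u_pos[OF \<open>i < n\<close>] unfolding scale[OF \<open>i < n\<close>]
      by (simp add: mult.commute)
  qed
  define R where "R = Max ((\<lambda>i. norm (v i)) ` {..<n})"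
  have R: "norm (v i) \<le> R" if "i < n" for i using that by (auto simp: R_def intro!: Max_ge)
  have "R \<in> (\<lambda>i. norm (v i)) ` {..<n}" unfolding R_def using n by (intro Max_in) auto
  then obtain i0 where i0: "i0 < n" "norm (v i0) = R" by auto
  obtain i1 where "i1 < n" "w i1 \<noteq> 0" using w_nz by auto
  then have "norm (v i1) > 0" using w_v by auto
  then have R_pos: "R > 0" using R[OF \<open>i1 < n\<close>] by linarith
  have norm_mu: "norm \<mu> \<le> 1" using z q by (simp add: \<mu>_def norm_divide)
  define s where "s = sqrt (1 - norm \<mu> ^ (2 * n))"
  have close: "\<exists>i<n. norm (v i - \<mu> ^ k * v i0) \<le> R * s" if "k \<le> n" for k
  proof -
    obtain i where i: "i < n" "(norm (v i - \<mu> ^ k * v i0))\<^sup>2 \<le> R\<^sup>2 - (norm (\<mu> ^ k * v i0))\<^sup>2"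
      using orbit_close_to_vertex[where m = "\<mu> ^ k" and v = v, OF n inv i0(1) R] by blast
    have "(norm (\<mu> ^ k * v i0))\<^sup>2 = R\<^sup>2 * norm \<mu> ^ (2 * k)"
      using i0 by (simp add: norm_mult norm_power power_mult_distrib power_mult[symmetric] mult.commute)
    moreover have "norm \<mu> ^ (2 * k) \<ge> norm \<mu> ^ (2 * n)"
      using that norm_mu by (intro power_decreasing) auto
    ultimately have "(norm (v i - \<mu> ^ k * v i0))\<^sup>2 \<le> R\<^sup>2 * (1 - norm \<mu> ^ (2 * n))"
      using i(2) mult_left_mono[of "norm \<mu> ^ (2 * n)" "norm \<mu> ^ (2 * k)" "R\<^sup>2"]
      by (simp add: right_diff_distrib)
    then have "norm (v i - \<mu> ^ k * v i0) \<le> sqrt (R\<^sup>2 * (1 - norm \<mu> ^ (2 * n)))"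
      by (rule real_le_rsqrt)
    then show ?thesis using i(1) R_pos by (auto simp: s_def real_sqrt_mult)
  qed
  define g where "g k = (SOME i. i < n \<and> norm (v i - \<mu> ^ k * v i0) \<le> R * s)" for k
  have g: "g k < n \<and> norm (v (g k) - \<mu> ^ k * v i0) \<le> R * s" if "k \<le> n" for k
    unfolding g_def by (rule someI_ex) (use close[OF that] in auto)
  have "\<not> inj_on g {..n}"
  proof
    assume "inj_on g {..n}"
    then have "card {..n} \<le> card {..<n}" by (rule card_inj_on_le) (use g in auto)
    then show False by simp
  qed
  then obtain k l where kl: "k \<le> n" "l \<le> n" "g k = g l" "k \<noteq> l" by (auto simp: inj_on_def)
  define k1 k2 where "k1 = min k l" and "k2 = max k l"
  have k12: "k1 < k2" "k2 \<le> n" "g k1 = g k2" using kl by (auto simp: k1_def k2_def min_def max_def)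
  have "\<mu> ^ k1 * v i0 - \<mu> ^ k2 * v i0 = (v (g k2) - \<mu> ^ k2 * v i0) - (v (g k1) - \<mu> ^ k1 * v i0)"
    using k12 by simp
  then have "norm (\<mu> ^ k1 * v i0 - \<mu> ^ k2 * v i0) \<le> R * s + R * s"
    using g[of k1] g[of k2] k12 norm_triangle_ineq4[of "v (g k2) - \<mu> ^ k2 * v i0" "v (g k1) - \<mu> ^ k1 * v i0"] by simp
  moreover have "norm (\<mu> ^ k1 * v i0 - \<mu> ^ k2 * v i0) = norm (\<mu> ^ k1 - \<mu> ^ k2) * R"
    using i0 by (simp add: norm_mult flip: left_diff_distrib)
  ultimately have "norm (\<mu> ^ k1 - \<mu> ^ k2) * R \<le> (2 * s) * R" by (simp add: mult_ac)
  then have "norm (\<mu> ^ k1 - \<mu> ^ k2) \<le> 2 * s" using R_pos by simp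
  then show ?thesis using k12 unfolding s_def by blast
qed

lemma aperiodic_eigenvalue_recurrence:
  fixes z :: complex
  assumes A: "aperiodic_mat n A" and n: "n > 0"
    and s: "spectral_radius (map_mat of_int A) = s" "s > 0"
    and z: "eigenvalue (map_mat of_int A) z"
  defines "\<mu> \<equiv> z / of_real s"
  shows "\<exists>k k'. k < k' \<and> k' \<le> n \<and> norm (\<mu> ^ k - \<mu> ^ k') \<le> 2 * sqrt (1 - norm \<mu> ^ (2 * n))"
proof -
  have Ac: "map_mat of_int A \<in> carrier_mat n n" using A by (simp add: aperiodic_mat_def)
  obtain x :: "nat \<Rightarrow> real" where x: "\<And>i. i < n \<Longrightarrow> x i > 0"
    "\<And>i. i < n \<Longrightarrow> (\<Sum>j<n. of_int (A $$ (i, j)) * x j) = s * x i"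
    using perron_frobenius_eigenvector[OF A n] s by blast
  obtain w where w: "w \<in> carrier_vec n" "w \<noteq> 0\<^sub>v n" "map_mat of_int A *\<^sub>v w = z \<cdot>\<^sub>v w"
    using z Ac unfolding eigenvalue_def eigenvector_def by auto
  show ?thesis unfolding \<mu>_def
  proof (rule eigenvalue_orbit_recurrence[where a = "\<lambda>i j. of_int (A $$ (i, j))" and u = x and w = "\<lambda>i. w $ i"])
    show "(\<Sum>j<n. of_real (of_int (A $$ (i, j))) * w $ j) = z * w $ i" if "i < n" for i
    proof -
      have "(map_mat of_int A *\<^sub>v w) $ i = (\<Sum>j<n. of_real (of_int (A $$ (i, j))) * w $ j)"
        using that Ac w(1) by (subst mult_mat_vec_entry[OF Ac]) auto
      then show ?thesis using w that by simp
    qed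
    show "\<exists>i<n. w $ i \<noteq> 0" using w(1,2) by (force simp: vec_eq_iff)
    show "norm z \<le> s"
      unfolding s(1)[symmetric]
      by (rule spectral_radius_mem_max(2)[OF Ac n]) (use z in \<open>auto simp: spectrum_def\<close>)
  qed (use x s A in \<open>auto simp: aperiodic_mat_def\<close>)
qed

section \<open>Rational minimal polynomials and Galois conjugates\<close>

lemma min_poly_rat:
  assumes "algebraic x"
  shows "lead_coeff (min_poly_rat x) = 1" "irreducible (min_poly_rat x)"
    "poly (map_poly of_rat (min_poly_rat x)) x = 0"
  using theI'[OF min_poly_rat_ex1[OF assms]] unfolding min_poly_rat_def by auto

lemma map_poly_of_rat_dvd_root:
  assumes "p dvd r" "poly (map_poly of_rat p) z = 0"
  shows "poly (map_poly of_rat r) (z :: complex) = 0"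
  using assms by (auto elim!: dvdE simp: map_poly_of_rat_mult)

text \<open>By Bezout, the common root is also a root of the greatest common divisor, which is therefore
  not a unit and must be associated to \<open>p\<close>.\<close>

lemma irreducible_common_root_dvd:
  fixes p r :: "rat poly"
  assumes "irreducible p" "poly (map_poly of_rat p) z = 0" "poly (map_poly of_rat r) (z :: complex) = 0"
  shows "p dvd r"
proof -
  obtain s t where st: "s * p + t * r = gcd p r" by (metis bezout_coefficients_fst_snd)
  have "poly (map_poly of_rat (gcd p r)) z = 0"
    unfolding st[symmetric] using assms(2,3) by (simp add: map_poly_of_rat_add map_poly_of_rat_mult)
  then have "\<not> gcd p r dvd 1"
    using map_poly_of_rat_dvd_root[of "gcd p r" 1 z] by auto
  moreover obtain c where "p = gcd p r * c" by (meson dvdE gcd_dvd1)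
  ultimately have "c dvd 1" using irreducibleD[OF assms(1)] by blast
  then have "p dvd gcd p r"
    using \<open>p = gcd p r * c\<close> by (metis dvd_refl mult_unit_dvd_iff)
  then show ?thesis by (meson dvd_trans gcd_dvd2)
qed

lemma galois_conjugates_root:
  assumes "algebraic x" "poly (map_poly of_rat r) x = 0" "z \<in> galois_conjugates x"
  shows "poly (map_poly of_rat r) z = 0"
proof (rule map_poly_of_rat_dvd_root)
  show "min_poly_rat x dvd r"
    using irreducible_common_root_dvd min_poly_rat[OF assms(1)] assms(2) by blast
qed (use assms(3) in \<open>simp add: galois_conjugates_def\<close>)

lemma map_poly_of_rat_of_int: "map_poly of_rat (of_int_poly p) = (of_int_poly p :: complex poly)"
  by (intro poly_eqI) (simp add: coeff_map_poly)

lemma galois_conjugates_root_int: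
  assumes "algebraic x" "poly (of_int_poly r) x = 0" "z \<in> galois_conjugates x"
  shows "poly (of_int_poly r) z = 0"
  using galois_conjugates_root[OF assms(1), of "of_int_poly r"] assms by (simp add: map_poly_of_rat_of_int)

lemma cnj_of_rat: "cnj (of_rat r) = of_rat r"
  by (cases r) (simp add: of_rat_rat)

lemma galois_conjugates_cnj:
  assumes "z \<in> galois_conjugates x"
  shows "cnj z \<in> galois_conjugates x"
proof -
  have "poly (map_poly of_rat p) (cnj z) = cnj (poly (map_poly of_rat p) z)" for p :: "rat poly"
    
    by (induction p) (simp_all add: map_poly_pCons cnj_of_rat)
  then show ?thesis using assms by (simp add: galois_conjugates_def)
qed

lemma self_mem_galois_conjugates: "algebraic x \<Longrightarrow> x \<in> galois_conjugates x"
  using min_poly_rat(3) by (simp add: galois_conjugates_def)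

text \<open>An irreducible rational polynomial does not divide its derivative, so its complex roots are
  simple, and a product over the set of roots recovers the whole polynomial.\<close>

lemma min_poly_rat_factorization:
  assumes "algebraic x"
  shows "finite (galois_conjugates x)"
    "map_poly of_rat (min_poly_rat x) = (\<Prod>z\<in>galois_conjugates x. [:-z, 1:])"
proof -
  define p where "p = min_poly_rat x"
  define P where "P = map_poly (of_rat :: rat \<Rightarrow> complex) p"
  have p: "lead_coeff p = 1" "irreducible p" "poly P x = 0" using min_poly_rat[OF assms] by (auto simp: p_def P_def)
  have P_deg: "degree P = degree p" unfolding P_def by (intro degree_map_poly) auto
  have P_lead: "lead_coeff P = 1" using p(1) by (simp add: P_deg) (simp add: P_def coeff_map_poly)
  have P0: "P \<noteq> 0" using P_lead by auto
  have P'_eq: "pderiv P = map_poly of_rat (pderiv p)"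
    unfolding P_def by (intro poly_eqI) (simp add: coeff_map_poly coeff_pderiv of_rat_mult of_rat_add)
  have "rsquarefree P"
    unfolding rsquarefree_roots
  proof (intro allI notI)
    fix z assume "poly P z = 0 \<and> poly (pderiv P) z = 0"
    then have "p dvd pderiv p"
      using irreducible_common_root_dvd[OF p(2), of z "pderiv p"] unfolding P'_eq by (simp add: P_def)
    moreover have "degree p \<noteq> 0"
    proof
      assume "degree p = 0"
      then show False using p(2) by (metis is_unit_iff_degree irreducible_not_unit not_irreducible_zero)
    qed
    ultimately show False using not_dvd_pderiv by blast
  qed
  then have "smult (lead_coeff P) (\<Prod>z | poly P z = 0. [:-z, 1:]) = P"
    by (rule complex_poly_decompose_rsquarefree)
  then show "map_poly of_rat (min_poly_rat x) = (\<Prod>z\<in>galois_conjugates x. [:-z, 1:])"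
    unfolding P_lead by (simp add: P_def p_def galois_conjugates_def)
  show "finite (galois_conjugates x)"
    using poly_roots_finite[OF P0] by (simp add: P_def p_def galois_conjugates_def)
qed

lemma prod_galois_conjugates:
  assumes "algebraic x"
  shows "(\<Prod>z\<in>galois_conjugates x. z) =
    (-1) ^ card (galois_conjugates x) * of_rat (coeff (min_poly_rat x) 0)"
proof -
  have "of_rat (coeff (min_poly_rat x) 0) = poly (map_poly of_rat (min_poly_rat x)) (0 :: complex)"
    by (simp add: poly_0_coeff_0 coeff_map_poly)
  also have "\<dots> = (\<Prod>z\<in>galois_conjugates x. - z)"
    unfolding min_poly_rat_factorization(2)[OF assms] by (simp add: poly_prod)
  also have "\<dots> = (-1) ^ card (galois_conjugates x) * (\<Prod>z\<in>galois_conjugates x. z)"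
    by (simp add: prod_uminus)
  finally show ?thesis by (simp add: mult.assoc[symmetric] flip: power_mult_distrib)
qed

text \<open>By the Gauss lemma the factor \<open>m\<close> is integral, so its constant coefficient divides that of \<open>S\<close>.\<close>

lemma monic_rat_factor_of_unit_poly:
  fixes S :: "int poly" and m r :: "rat poly"
  assumes S: "lead_coeff S = 1" "coeff S 0 = 1 \<or> coeff S 0 = -1" and m: "lead_coeff m = 1"
    and fact: "of_int_poly S = m * r"
  shows "coeff m 0 = 1 \<or> coeff m 0 = -1"
proof -
  obtain c C where c: "rat_to_normalized_int_poly m = (c, C)" by fastforce
  obtain d D where d: "rat_to_normalized_int_poly r = (d, D)" by fastforce
  have S0: "S \<noteq> 0" using S(1) by auto
  have "content S dvd lead_coeff S" by (rule content_dvd_coeff)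
  then have "content S = 1" using S(1) content_ge_0_int[of S] by (simp add: zdvd1_eq)
  then have CD: "S = C * D" using rat_to_int_factor_content_1[OF _ fact c d S0] by simp
  have mC: "m = smult c (of_int_poly C)" and c_pos: "c > 0" "degree C = degree m"
    using rat_to_normalized_int_poly[OF c] by auto
  have "lead_coeff C * lead_coeff D = 1" using CD S(1) by (simp add: lead_coeff_mult)
  then have lead_C: "lead_coeff C = 1 \<or> lead_coeff C = -1" by (auto simp: zmult_eq_1_iff)
  have "lead_coeff m = c * of_int (lead_coeff C)"
    by (subst mC) (simp add: coeff_map_poly c_pos(2)[symmetric])
  then have "c * of_int (lead_coeff C) = 1" using m by simp
  then have "c = 1" using lead_C c_pos by auto
  have "coeff C 0 * coeff D 0 = coeff S 0" using CD by (simp add: coeff_mult)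
  then have "coeff C 0 dvd 1" using S(2) by (metis dvd_triv_left dvd_minus_iff)
  then have "coeff C 0 = 1 \<or> coeff C 0 = -1" by (auto simp: zdvd1_eq abs_if split: if_splits)
  then show ?thesis by (auto simp: mC \<open>c = 1\<close> coeff_map_poly)
qed

lemma unit_algebraic_intI:
  fixes S :: "int poly"
  assumes S: "lead_coeff S = 1" "coeff S 0 = 1 \<or> coeff S 0 = -1" and root: "poly (of_int_poly S) x = 0"
  shows "unit_algebraic_int x"
proof -
  have "algebraic_int x" unfolding algebraic_int_altdef_ipoly using S root by auto
  then have alg: "algebraic x" by auto
  have "min_poly_rat x dvd of_int_poly S"
    using irreducible_common_root_dvd min_poly_rat[OF alg] root map_poly_of_rat_of_int by metis
  then obtain r where r: "of_int_poly S = min_poly_rat x * r" by (rule dvdE)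
  have "coeff (min_poly_rat x) 0 = 1 \<or> coeff (min_poly_rat x) 0 = -1"
    by (rule monic_rat_factor_of_unit_poly[OF S min_poly_rat(1)[OF alg] r])
  then have "(\<Prod>z\<in>galois_conjugates x. z) \<in> {1, -1}"
    unfolding prod_galois_conjugates[OF alg]
    by (cases "even (card (galois_conjugates x))") auto
  then show ?thesis using \<open>algebraic_int x\<close> by (simp add: unit_algebraic_int_def)
qed

text \<open>The minimal polynomial is either linear, so that \<open>x\<close> is rational, or it is
  \<open>X\<^sup>2 - (x + 1 / x) X + 1\<close>, and its linear coefficient is rational.\<close>

lemma rational_trace_of_reciprocal_pair:
  assumes alg: "algebraic x" and "x \<noteq> 0" "x \<noteq> inverse x" and sub: "galois_conjugates x \<subseteq> {x, inverse x}"
  shows "x + inverse x \<in> \<rat>"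
proof -
  have coeff_rat: "coeff (\<Prod>z\<in>galois_conjugates x. [:-z, 1:]) k \<in> \<rat>" for k
    unfolding min_poly_rat_factorization(2)[OF alg, symmetric] by (simp add: coeff_map_poly)
  have "x \<in> galois_conjugates x" by (rule self_mem_galois_conjugates[OF alg])
  with sub consider "galois_conjugates x = {x}" | "galois_conjugates x = {x, inverse x}" by blast
  then show ?thesis
  proof cases
    case 1
    then have "- x \<in> \<rat>" using coeff_rat[of 0] by simp
    then show ?thesis by (simp add: Rats_minus_iff)
  next
    case 2
    then have "- (x + inverse x) \<in> \<rat>"
      using coeff_rat[of 1] assms(2,3) by (simp add: algebra_simps)
    then show ?thesis unfolding Rats_minus_iff .
  qed
qed

section \<open>Multipliers without close returns\<close>

text \<open>Multipliers in the open unit disk whose powers up to the \<open>N\<close>-th are further apart than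
  \<open>eigenvalue_orbit_recurrence\<close> permits for a matrix of size at most \<open>N\<close>. The bound uses the
  exponent \<open>2 * N\<close> for all smaller sizes at once.\<close>

definition spiral_params :: "nat \<Rightarrow> complex set" where
  "spiral_params N = {\<mu>. norm \<mu> < 1 \<and>
     (\<forall>k\<le>N. \<forall>k'\<le>N. k < k' \<longrightarrow> 2 * sqrt (1 - norm \<mu> ^ (2 * N)) < norm (\<mu> ^ k - \<mu> ^ k'))}"

lemma open_spiral_params: "open (spiral_params N)"
proof -
  have "spiral_params N = {\<mu>. norm \<mu> < 1} \<inter> (\<Inter>k\<in>{..N}. \<Inter>k'\<in>{k<..N}.
      {\<mu>. 2 * sqrt (1 - norm \<mu> ^ (2 * N)) < norm (\<mu> ^ k - \<mu> ^ k')})"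
    by (force simp: spiral_params_def)
  also have "open \<dots>"
    by (intro open_Int open_INT ballI finite_atMost finite_greaterThanAtMost open_Collect_less continuous_intros)
  finally show ?thesis .
qed

lemma cis_power_neq_1:
  assumes "0 < m" "m \<le> N" "0 < N"
  shows "cis (2 * pi / (3 * real N)) ^ m \<noteq> 1"
proof
  assume "cis (2 * pi / (3 * real N)) ^ m = 1"
  then have "cis (real m * (2 * pi / (3 * real N))) = 1" by (simp add: DeMoivre)
  then have "cos (real m * (2 * pi / (3 * real N))) = 1" by (simp add: complex_eq_iff)
  moreover have "real m * (2 * pi / (3 * real N)) \<le> real N * (2 * pi / (3 * real N))"
    using assms by (intro mult_right_mono) auto
  then have "real m * (2 * pi / (3 * real N)) \<le> pi" using assms by (simp add: field_simps)
  moreover have "real m * (2 * pi / (3 * real N)) > 0" using assms by simp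
  ultimately show False
    using cos_monotone_0_pi[of 0 "real m * (2 * pi / (3 * real N))"] by simp
qed

text \<open>On the circle the powers of \<open>cis (2 * pi / (3 * N))\<close> up to the \<open>N\<close>-th are distinct, while the
  permitted distance \<open>2 * sqrt (1 - \<rho> ^ (2 * N))\<close> tends to \<open>0\<close> as the radius \<open>\<rho>\<close> tends to \<open>1\<close>. The angle is such that the
  \<open>N\<close>-th power has argument \<open>2 * pi / 3\<close>; then \<open>- 2 * Re (\<mu> ^ N) = \<rho> ^ N\<close> lies strictly between
  \<open>\<rho> ^ (2 * N)\<close> and \<open>1\<close>, as \<open>ex_positive_renewal_multiple\<close> requires.\<close>

lemma ex_spiral_param:
  assumes N: "N > 0"
  shows "\<exists>\<mu>\<in>spiral_params N. Im \<mu> > 0 \<and> norm \<mu> ^ (2 * N) < - 2 * Re (\<mu> ^ N) \<and> - 2 * Re (\<mu> ^ N) < 1"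
proof -
  define \<theta> where "\<theta> = 2 * pi / (3 * real N)"
  define \<mu> where "\<mu> \<rho> = complex_of_real \<rho> * cis \<theta>" for \<rho>
  have norm_mu: "norm (\<mu> \<rho>) = \<bar>\<rho>\<bar>" for \<rho> by (simp add: \<mu>_def norm_mult)
  have lim: "eventually (\<lambda>\<rho>. 2 * sqrt (1 - norm (\<mu> \<rho>) ^ (2 * N)) < norm (\<mu> \<rho> ^ k - \<mu> \<rho> ^ k')) (at_left 1)"
    if "k < k'" "k' \<le> N" for k k'
  proof -
    have "((\<lambda>\<rho>. norm (\<mu> \<rho> ^ k - \<mu> \<rho> ^ k') - 2 * sqrt (1 - norm (\<mu> \<rho>) ^ (2 * N))) \<longlongrightarrow>
        norm (\<mu> 1 ^ k - \<mu> 1 ^ k') - 2 * sqrt (1 - norm (\<mu> 1) ^ (2 * N))) (at_left 1)"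
      unfolding \<mu>_def by (intro tendsto_intros)
    moreover have "norm (\<mu> 1 ^ k - \<mu> 1 ^ k') > 0"
    proof -
      have "\<mu> 1 ^ k' = \<mu> 1 ^ k * cis \<theta> ^ (k' - k)" using that
        by (simp add: \<mu>_def flip: power_add)
      moreover have "cis \<theta> ^ (k' - k) \<noteq> 1"
        unfolding \<theta>_def using that N by (intro cis_power_neq_1) auto
      ultimately show ?thesis by (auto simp: \<mu>_def)
    qed
    ultimately have "eventually (\<lambda>\<rho>. 0 < norm (\<mu> \<rho> ^ k - \<mu> \<rho> ^ k') - 2 * sqrt (1 - norm (\<mu> \<rho>) ^ (2 * N))) (at_left 1)"
      by (intro order_tendstoD(1)) (auto simp: norm_mu)
    then show ?thesis by (rule eventually_mono) simp
  qed
  have "eventually (\<lambda>\<rho>. \<forall>k\<in>{..N}. \<forall>k'\<in>{k<..N}.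
      2 * sqrt (1 - norm (\<mu> \<rho>) ^ (2 * N)) < norm (\<mu> \<rho> ^ k - \<mu> \<rho> ^ k')) (at_left 1)"
    by (intro eventually_ball_finite ballI lim) auto
  moreover have "eventually (\<lambda>\<rho>::real. \<rho> \<in> {0<..<1}) (at_left 1)"
    by (rule eventually_at_left_real) simp
  ultimately have "eventually (\<lambda>\<rho>. (\<forall>k\<in>{..N}. \<forall>k'\<in>{k<..N}.
      2 * sqrt (1 - norm (\<mu> \<rho>) ^ (2 * N)) < norm (\<mu> \<rho> ^ k - \<mu> \<rho> ^ k')) \<and> \<rho> \<in> {0<..<1}) (at_left (1::real))"
    by (rule eventually_conj)
  then obtain \<rho> :: real where \<rho>: "\<rho> \<in> {0<..<1}" "\<forall>k\<in>{..N}. \<forall>k'\<in>{k<..N}.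
      2 * sqrt (1 - norm (\<mu> \<rho>) ^ (2 * N)) < norm (\<mu> \<rho> ^ k - \<mu> \<rho> ^ k')"
    using eventually_happens' trivial_limit_at_left_real by (metis (no_types, lifting))
  have "\<mu> \<rho> ^ N = of_real (\<rho> ^ N) * cis (2 * pi / 3)"
    using N by (simp add: \<mu>_def power_mult_distrib DeMoivre \<theta>_def)
  moreover have "cos (2 * pi / 3) = - 1 / (2 :: real)" by (simp add: cos_120)
  ultimately have Re: "- 2 * Re (\<mu> \<rho> ^ N) = \<rho> ^ N" by simp
  show ?thesis
  proof (intro bexI conjI)
    show "\<mu> \<rho> \<in> spiral_params N" using \<rho> by (auto simp: spiral_params_def norm_mu)
    have "2 * pi / (3 * real N) < pi" using N by (simp add: field_simps) 
    then have "sin \<theta> > 0" using N by (intro sin_gt_zero) (auto simp: \<theta>_def)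
    then show "Im (\<mu> \<rho>) > 0" using \<rho> by (simp add: \<mu>_def)
    show "norm (\<mu> \<rho>) ^ (2 * N) < - 2 * Re (\<mu> \<rho> ^ N)"
      unfolding Re norm_mu using \<rho> N by (auto intro!: power_strict_decreasing)
    show "- 2 * Re (\<mu> \<rho> ^ N) < 1" unfolding Re using \<rho> N by (auto intro!: power_Suc_less_one simp: power_less_one_iff)
  qed
qed

lemma Gaussian_rational_dense:
  assumes "open S" "x \<in> S"
  shows "\<exists>z\<in>S. Re z \<in> \<rat> \<and> Im z \<in> \<rat>"
proof -
  obtain e where e: "e > 0" "\<And>y. dist y x < e \<Longrightarrow> y \<in> S"
    using assms unfolding open_dist by blast
  obtain r where r: "r \<in> \<rat>" "\<bar>r - Re x\<bar> < e / 2"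
  proof -
    obtain r where "r \<in> \<rat>" "Re x - e / 2 < r" "r < Re x + e / 2"
      using Rats_dense_in_real[of "Re x - e / 2" "Re x + e / 2"] e(1) by auto
    then show ?thesis by (intro that[of r]) (unfold abs_less_iff, auto)
  qed
  obtain s where s: "s \<in> \<rat>" "\<bar>s - Im x\<bar> < e / 2"
  proof -
    obtain r where "r \<in> \<rat>" "Im x - e / 2 < r" "r < Im x + e / 2"
      using Rats_dense_in_real[of "Im x - e / 2" "Im x + e / 2"] e(1) by auto
    then show ?thesis by (intro that[of r]) (unfold abs_less_iff, auto)
  qed
  have "dist (Complex r s) x \<le> \<bar>r - Re x\<bar> + \<bar>s - Im x\<bar>"
    unfolding dist_norm using cmod_le[of "Complex r s - x"] by simp
  then have "Complex r s \<in> S" using r s by (intro e(2)) linarith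
  then show ?thesis using r s by (intro bexI[of _ "Complex r s"]) auto
qed

text \<open>All the conditions on \<open>\<mu>\<close> are strict inequalities between continuous functions, so they
  survive a small move to a Gaussian rational.\<close>

lemma ex_Gaussian_rational_spiral_param:
  assumes N: "N > 0"
  shows "\<exists>\<mu>\<in>spiral_params N. Re \<mu> \<in> \<rat> \<and> Im \<mu> \<in> \<rat> \<and> Im \<mu> > 0 \<and>
    norm \<mu> ^ (2 * N) < - 2 * Re (\<mu> ^ N) \<and> - 2 * Re (\<mu> ^ N) < 1"
proof -
  define S where "S = spiral_params N \<inter> {\<mu>. Im \<mu> > 0} \<inter>
    {\<mu>. norm \<mu> ^ (2 * N) < - 2 * Re (\<mu> ^ N)} \<inter> {\<mu>. - 2 * Re (\<mu> ^ N) < 1}"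
  have "open S" unfolding S_def
    by (intro open_Int open_spiral_params open_Collect_less continuous_intros)
  moreover obtain x where "x \<in> S" using ex_spiral_param[OF N] by (auto simp: S_def)
  ultimately obtain z where "z \<in> S" "Re z \<in> \<rat>" "Im z \<in> \<rat>" using Gaussian_rational_dense by blast
  then show ?thesis by (auto simp: S_def)
qed

section \<open>Renewal equations from rational quadratics\<close>

definition geom_poly :: "'a :: comm_ring_1 \<Rightarrow> nat \<Rightarrow> 'a poly" where
  "geom_poly c N = (\<Sum>i<N. monom (c ^ i) i)"

lemma coeff_geom_poly: "coeff (geom_poly c N) k = (if k < N then c ^ k else 0)"
  by (simp add: geom_poly_def coeff_sum)

lemma poly_geom_poly: "poly (geom_poly c N) y = (\<Sum>i<N. (c * y) ^ i)"
  by (simp add: geom_poly_def poly_sum poly_monom power_mult_distrib)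

lemma degree_geom_poly: "degree (geom_poly c N) \<le> N - 1"
  by (rule degree_le) (auto simp: coeff_geom_poly)

lemma poly_geom_poly_mult: "(1 - c * y) * poly (geom_poly c N) y = 1 - (c * y) ^ N"
  unfolding poly_geom_poly by (rule one_diff_power_eq[symmetric])

text \<open>The quotient is the product of \<open>(\<Sum>i<N. (\<mu> * y) ^ i)\<close> and its complex conjugate. Its coefficients are
  Gaussian rationals and real, hence rational.\<close>

lemma real_quadratic_quotient:
  fixes \<mu> :: complex
  assumes \<mu>: "Re \<mu> \<in> \<rat>" "Im \<mu> \<in> \<rat>" and N: "N > 0"
  shows "\<exists>U :: real poly. (\<forall>k. coeff U k \<in> \<rat>) \<and> coeff U 0 = 1 \<and> degree U \<le> 2 * (N - 1) \<and>
    (\<forall>y. (1 - 2 * Re \<mu> * y + (norm \<mu>)\<^sup>2 * y\<^sup>2) * poly U y = 1 - 2 * Re (\<mu> ^ N) * y ^ N + norm \<mu> ^ (2 * N) * y ^ (2 * N))"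
proof -
  \<comment> \<open>the Gaussian rationals\<close>
  define Q where "Q = {z. Re z \<in> \<rat> \<and> Im z \<in> \<rat>}"
  have Q_mult: "x * y \<in> Q" if "x \<in> Q" "y \<in> Q" for x y using that by (auto simp: Q_def)
  have Q_pow: "x ^ k \<in> Q" if "x \<in> Q" for x k
    using that by (induction k) (auto intro: Q_mult simp: Q_def)
  have Q_sum: "sum f A \<in> Q" if "\<And>i. i \<in> A \<Longrightarrow> f i \<in> Q" for f and A :: "nat set"
    using that by (induction A rule: infinite_finite_induct) (auto simp: Q_def)
  define V where "V = geom_poly \<mu> N * geom_poly (cnj \<mu>) N"
  have coeff_Q: "coeff (geom_poly \<mu> N) k \<in> Q" "coeff (geom_poly (cnj \<mu>) N) k \<in> Q" for k
    using Q_pow[of \<mu>] Q_pow[of "cnj \<mu>"] \<mu> by (auto simp: coeff_geom_poly Q_def)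
  have V_Q: "coeff V k \<in> Q" for k
    unfolding V_def coeff_mult by (intro Q_sum Q_mult coeff_Q)
  have cnj_coeff: "cnj (coeff (geom_poly c N) k) = coeff (geom_poly (cnj c) N) k" for c k
    by (simp add: coeff_geom_poly)
  have "cnj (coeff V k) = coeff V k" for k
  proof -
    have "cnj (coeff V k) = coeff (geom_poly (cnj \<mu>) N * geom_poly \<mu> N) k"
      unfolding V_def coeff_mult by (simp add: cnj_coeff)
    then show ?thesis by (simp add: V_def mult.commute)
  qed
  then have V_real: "coeff V k = of_real (Re (coeff V k))" for k
    by (metis Reals_cnj_iff of_real_Re)
  define U where "U = map_poly Re V"
  have coeff_U: "coeff U k = Re (coeff V k)" for k by (simp add: U_def coeff_map_poly)
  have V_U: "V = map_poly of_real U"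
    by (intro poly_eqI) (simp add: coeff_map_poly coeff_U V_real[symmetric])
  show ?thesis
  proof (intro exI[of _ U] conjI allI)
    show "coeff U k \<in> \<rat>" for k using V_Q[of k] by (simp add: coeff_U Q_def)
    show "coeff U 0 = 1" using N by (simp add: coeff_U V_def coeff_mult coeff_geom_poly)
    have "degree U \<le> degree V" unfolding U_def by (rule degree_map_poly_le)
    also have "\<dots> \<le> (N - 1) + (N - 1)"
      unfolding V_def using degree_mult_le[of "geom_poly \<mu> N" "geom_poly (cnj \<mu>) N"]
        degree_geom_poly[of \<mu> N] degree_geom_poly[of "cnj \<mu>" N] by linarith
    finally show "degree U \<le> 2 * (N - 1)" by simp
    fix y :: real
    have "complex_of_real ((1 - 2 * Re \<mu> * y + (norm \<mu>)\<^sup>2 * y\<^sup>2) * poly U y) =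
        ((1 - \<mu> * of_real y) * (1 - cnj \<mu> * of_real y)) * poly V (of_real y)"
    proof -
      have "(1 - \<mu> * of_real y) * (1 - cnj \<mu> * of_real y) = 1 - (\<mu> + cnj \<mu>) * of_real y + (\<mu> * cnj \<mu>) * (of_real y)\<^sup>2"
        by (simp add: algebra_simps power2_eq_square)
      also have "\<dots> = of_real (1 - 2 * Re \<mu> * y + (norm \<mu>)\<^sup>2 * y\<^sup>2)"
        by (simp add: complex_add_cnj flip: complex_norm_square)
      finally show ?thesis by (simp add: V_U)
    qed
    also have "\<dots> = ((1 - \<mu> * of_real y) * poly (geom_poly \<mu> N) (of_real y)) *
        ((1 - cnj \<mu> * of_real y) * poly (geom_poly (cnj \<mu>) N) (of_real y))"
      by (simp add: V_def)
    also have "\<dots> = (1 - \<mu> ^ N * of_real (y ^ N)) * (1 - cnj (\<mu> ^ N) * of_real (y ^ N))"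
      unfolding poly_geom_poly_mult by (simp add: power_mult_distrib)
    also have "\<dots> = 1 - (\<mu> ^ N + cnj (\<mu> ^ N)) * of_real (y ^ N) + (\<mu> ^ N * cnj (\<mu> ^ N)) * (of_real (y ^ N))\<^sup>2"
      by (simp add: algebra_simps power2_eq_square)
    also have "\<dots> = of_real (1 - 2 * Re (\<mu> ^ N) * y ^ N + norm \<mu> ^ (2 * N) * y ^ (2 * N))"
      unfolding complex_add_cnj complex_norm_square[symmetric]
      by (simp add: norm_power power_mult mult.commute[of 2 N])
    finally show "(1 - 2 * Re \<mu> * y + (norm \<mu>)\<^sup>2 * y\<^sup>2) * poly U y = 1 - 2 * Re (\<mu> ^ N) * y ^ N + norm \<mu> ^ (2 * N) * y ^ (2 * N)"
      unfolding of_real_eq_iff .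
  qed
qed

lemma telescoping_product:
  fixes w :: "nat \<Rightarrow> 'a :: comm_ring_1"
  shows "(1 - y) * (\<Sum>j<n. w j * y ^ j) = w 0 - (\<Sum>j<n. (w j - w (Suc j)) * y ^ Suc j) - w n * y ^ n"
  by (induction n) (simp_all add: algebra_simps)

lemma ex_near_one_rational:
  fixes r :: real
  assumes "r < 1"
  shows "\<exists>a\<in>\<rat>. 0 < a \<and> a < 1 \<and> r < a ^ m"
proof -
  have "((\<lambda>a::real. a ^ m) \<longlongrightarrow> 1 ^ m) (at_left 1)" by (intro tendsto_intros)
  then have "eventually (\<lambda>a. r < a ^ m) (at_left 1)" using assms by (intro order_tendstoD(1)) auto
  moreover have "eventually (\<lambda>a::real. a \<in> {0<..<1}) (at_left 1)"
    by (rule eventually_at_left_real) simp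
  ultimately have "eventually (\<lambda>a. r < a ^ m \<and> a \<in> {0<..<1}) (at_left 1)" by (rule eventually_conj)
  then obtain b where b: "r < b ^ m" "b \<in> {0<..<1}"
    using eventually_happens' trivial_limit_at_left_real by (metis (no_types, lifting))
  obtain a where a: "a \<in> \<rat>" "b < a" "a < 1" using Rats_dense_in_real[of b 1] b by auto
  have "b ^ m \<le> a ^ m" using a b by (intro power_mono) auto
  then show ?thesis using a b by (intro bexI[of _ a]) auto
qed

text \<open>With \<open>\<beta> = - 2 * Re (\<mu> ^ N)\<close> and \<open>\<gamma> = \<bar>\<mu>\<bar> ^ (2 * N)\<close>, the quadratic divides \<open>1 + \<beta> * y ^ N + \<gamma> * y ^ (2 * N)\<close>,
  whose coefficients decrease since \<open>1 > \<beta> > \<gamma>\<close>. Multiplication by \<open>(\<Sum>i<N. (a * y) ^ i)\<close> with \<open>a\<close> slightly below \<open>1\<close>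
  fills the gaps and makes the coefficients \<open>w j\<close> strictly decreasing. The further factor \<open>1 - y\<close> then
  produces the coefficients \<open>w (j + 1) - w j < 0\<close>.\<close>

lemma ex_positive_renewal_multiple:
  fixes \<mu> :: complex
  assumes \<mu>: "Re \<mu> \<in> \<rat>" "Im \<mu> \<in> \<rat>" "\<mu> \<noteq> 0" and N: "N > 0"
    and small: "norm \<mu> ^ (2 * N) < - 2 * Re (\<mu> ^ N)" "- 2 * Re (\<mu> ^ N) < 1"
  shows "\<exists>(G :: real poly) p. (\<forall>k. coeff G k \<in> \<rat>) \<and> coeff G 0 = 1 \<and> degree G \<le> 3 * N - 3 \<and>
    (\<forall>j<3 * N. p j \<in> \<rat> \<and> p j > 0) \<and>
    (\<forall>y. (1 - y) * (1 - 2 * Re \<mu> * y + (norm \<mu>)\<^sup>2 * y\<^sup>2) * poly G y = 1 - (\<Sum>j<3 * N. p j * y ^ Suc j))"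
proof -
  obtain U :: "real poly" where U: "\<And>k. coeff U k \<in> \<rat>" "coeff U 0 = 1" "degree U \<le> 2 * (N - 1)"
    "\<And>y. (1 - 2 * Re \<mu> * y + (norm \<mu>)\<^sup>2 * y\<^sup>2) * poly U y =
      1 - 2 * Re (\<mu> ^ N) * y ^ N + norm \<mu> ^ (2 * N) * y ^ (2 * N)"
    using real_quadratic_quotient[OF \<mu>(1,2) N] by blast
  define \<beta> \<gamma> where "\<beta> = - 2 * Re (\<mu> ^ N)" and "\<gamma> = norm \<mu> ^ (2 * N)"
  have \<gamma>: "\<gamma> > 0" using \<mu> by (simp add: \<gamma>_def)
  have ord: "\<gamma> < \<beta>" "\<beta> < 1" using small by (auto simp: \<beta>_def \<gamma>_def)
  have Q_pow: "Re (\<mu> ^ k) \<in> \<rat> \<and> Im (\<mu> ^ k) \<in> \<rat>" for k by (induction k) (use \<mu> in auto)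
  have \<beta>_rat: "\<beta> \<in> \<rat>" using Q_pow[of N] by (simp add: \<beta>_def)
  have "\<gamma> = (Re (\<mu> ^ N))\<^sup>2 + (Im (\<mu> ^ N))\<^sup>2"
    unfolding \<gamma>_def cmod_power2[symmetric] by (simp add: norm_power power_mult mult.commute[of 2 N])
  then have \<gamma>_rat: "\<gamma> \<in> \<rat>" using Q_pow[of N] by (auto intro!: Rats_add Rats_power)
  obtain a where a: "a \<in> \<rat>" "0 < a" "a < 1" "max \<beta> (\<gamma> / \<beta>) < a ^ (N - 1)"
    using ex_near_one_rational[of "max \<beta> (\<gamma> / \<beta>)" "N - 1"] ord \<gamma> by auto
  define G where "G = U * geom_poly a N"
  \<comment> \<open>the value \<open>0\<close> beyond \<open>l = 2\<close> makes \<open>w (3 * N) = 0\<close>, so the telescoped sum has no last term\<close>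
  define c where "c l = (if l = 0 then 1 else if l = 1 then \<beta> else if l = 2 then \<gamma> else 0)" for l :: nat
  define w where "w j = a ^ (j mod N) * c (j div N)" for j
  have w_rat: "w j \<in> \<rat>" for j using a \<beta>_rat \<gamma>_rat by (auto simp: w_def c_def)
  have c_step: "c (Suc l) < a ^ (N - 1) * c l" if "l < 3" for l
  proof -
    have "l = 0 \<or> l = 1 \<or> l = 2" using that by auto
    then show ?thesis using a ord \<gamma> by (auto simp: c_def field_simps)
  qed
  have c_pos: "c l > 0" if "l < 3" for l using that ord \<gamma> by (auto simp: c_def)
  have w_dec: "w (Suc j) < w j" if "j < 3 * N" for j
  proof -
    have l: "j div N < 3" using that N by (simp add: div_less_iff_less_mult)
    show ?thesis
    proof (cases "Suc (j mod N) = N")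
      case True
      then have "Suc j mod N = 0" "Suc j div N = Suc (j div N)" "j mod N = N - 1"
        using N by (auto simp: mod_Suc div_Suc)
      then show ?thesis using c_step[OF l] by (simp add: w_def)
    next
      case False
      then have "Suc j mod N = Suc (j mod N)" "Suc j div N = j div N"
        by (auto simp: mod_Suc div_Suc)
      then show ?thesis using c_pos[OF l] a by (simp add: w_def)
    qed
  qed
  have W: "(\<Sum>j<3 * N. w j * y ^ j) = (1 + \<beta> * y ^ N + \<gamma> * y ^ (2 * N)) * poly (geom_poly a N) y" for y
  proof -
    have "(\<Sum>j<3 * N. w j * y ^ j) = (\<Sum>l<3. \<Sum>j\<in>{l * N..<l * N + N}. w j * y ^ j)"
      by (rule sum.nat_group[symmetric])
    also have "\<dots> = (\<Sum>l<3. c l * y ^ (l * N) * (\<Sum>i<N. (a * y) ^ i))"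
    proof (intro sum.cong refl)
      fix l
      have "(\<Sum>j\<in>{l * N..<l * N + N}. w j * y ^ j) = (\<Sum>i<N. w (i + l * N) * y ^ (i + l * N))"
        using sum.shift_bounds_nat_ivl[of "\<lambda>j. w j * y ^ j" 0 "l * N" N]
        by (simp add: atLeast0LessThan add.commute)
      also have "\<dots> = (\<Sum>i<N. c l * y ^ (l * N) * (a * y) ^ i)"
        by (intro sum.cong) (auto simp: w_def power_add power_mult_distrib mult_ac)
      finally show "(\<Sum>j\<in>{l * N..<l * N + N}. w j * y ^ j) = c l * y ^ (l * N) * (\<Sum>i<N. (a * y) ^ i)"
        by (simp add: sum_distrib_left)
    qed
    also have "\<dots> = (1 + \<beta> * y ^ N + \<gamma> * y ^ (2 * N)) * poly (geom_poly a N) y"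
    proof -
      have "(\<Sum>l<3. F l) = F 0 + F 1 + F 2" for F :: "nat \<Rightarrow> real"
        by (simp add: eval_nat_numeral)
      then show ?thesis by (simp add: poly_geom_poly c_def distrib_right)
    qed
    finally show ?thesis .
  qed
  show ?thesis
  proof (rule exI[of _ G], rule exI[of _ "\<lambda>j. w j - w (Suc j)"], intro conjI allI impI)
    show "coeff G k \<in> \<rat>" for k
      unfolding G_def coeff_mult using U(1) a by (intro Rats_sum Rats_mult) (auto simp: coeff_geom_poly)
    show "coeff G 0 = 1" using U(2) N by (simp add: G_def coeff_mult coeff_geom_poly)
    show "degree G \<le> 3 * N - 3"
      using degree_mult_le[of U "geom_poly a N"] U(3) degree_geom_poly[of a N] N by (simp add: G_def)
    show "w j - w (Suc j) \<in> \<rat>" for j using w_rat by simp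
    show "w j - w (Suc j) > 0" if "j < 3 * N" for j using w_dec[OF that] by simp
    fix y :: real
    have "(1 - y) * (1 - 2 * Re \<mu> * y + (norm \<mu>)\<^sup>2 * y\<^sup>2) * poly G y =
      (1 - y) * (((1 - 2 * Re \<mu> * y + (norm \<mu>)\<^sup>2 * y\<^sup>2) * poly U y) * poly (geom_poly a N) y)"
      by (simp add: G_def mult_ac)
    also have "\<dots> = (1 - y) * (\<Sum>j<3 * N. w j * y ^ j)"
      unfolding U(4) W by (simp add: \<beta>_def \<gamma>_def)
    also have "\<dots> = 1 - (\<Sum>j<3 * N. (w j - w (Suc j)) * y ^ Suc j)"
      unfolding telescoping_product using N by (simp add: w_def c_def)
    finally show "(1 - y) * (1 - 2 * Re \<mu> * y + (norm \<mu>)\<^sup>2 * y\<^sup>2) * poly G y =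
      1 - (\<Sum>j<3 * N. (w j - w (Suc j)) * y ^ Suc j)" .
  qed
qed

lemma common_denominator:
  fixes R :: "real set"
  assumes "finite R" "R \<subseteq> \<rat>"
  shows "\<exists>D>0::nat. \<forall>r\<in>R. real D * r \<in> \<int>"
  using assms
proof (induction R)
  case empty
  then show ?case by (intro exI[of _ 1]) auto
next
  case (insert r R)
  then obtain D where D: "D > 0" "\<forall>r\<in>R. real D * r \<in> \<int>" by auto
  obtain m n where mn: "n > 0" "r = of_int m / of_int n"
    using insert.prems by (auto elim: Rats_cases')
  have n: "real (nat n) = of_int n" "of_int n * r = of_int m" using mn by simp_all
  have "real (D * nat n) * r = real D * of_int m" using n by simp
  then have "real (D * nat n) * r \<in> \<int>" by (metis Ints_mult Ints_of_int Ints_of_nat)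
  moreover have "real (D * nat n) * x \<in> \<int>" if "x \<in> R" for x
  proof -
    have "real (D * nat n) * x = of_int n * (real D * x)" using n(1) by simp
    then show ?thesis using D(2) that by (metis Ints_mult Ints_of_int)
  qed
  ultimately show ?case using D(1) mn(1) by (intro exI[of _ "D * nat n"]) (auto simp del: of_nat_mult)
qed

text \<open>At \<open>y = K / b\<close> the equation for \<open>b\<close> says that the product of the first factors in \<open>id\<close> is
  \<open>1 / b ^ 3\<close>. So \<open>id\<close> becomes a renewal equation for \<open>b\<close> with coefficients
  \<open>p j * K ^ (j + 1) + coeff G (j - 2) * K ^ (j - 2)\<close>, the second summand being the effect of the perturbation.\<close>

lemma ex_renewal_coefficients:
  fixes \<mu> :: complex and G :: "real poly" and p :: "nat \<Rightarrow> real" and K b :: real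
  assumes n: "n \<ge> 2" and G0: "coeff G 0 = 1" and deg: "degree G + 2 < n"
    and id: "\<And>y. (1 - y) * (1 - 2 * Re \<mu> * y + (norm \<mu>)\<^sup>2 * y\<^sup>2) * poly G y = 1 - (\<Sum>j<n. p j * y ^ Suc j)"
    and b: "(b - K) * (b\<^sup>2 - K * (2 * Re \<mu>) * b + K\<^sup>2 * (norm \<mu>)\<^sup>2) = 1" "b > 0"
    and K: "K \<in> \<int>" "K \<ge> 1" and p_int: "\<And>j. j < n \<Longrightarrow> K * p j \<in> \<int>" and G_int: "\<And>j. j < n \<Longrightarrow> K * coeff G j \<in> \<int>"
    and p_pos: "\<And>j. j < n \<Longrightarrow> p j > 0" and pos: "\<And>j. j < n \<Longrightarrow> K * p j + coeff G (j - 2) > 0"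
  shows "\<exists>a :: nat \<Rightarrow> int. (\<forall>j<n. a j > 0) \<and> (\<Sum>j<n. of_int (a j) / b ^ j) = b"
proof -
  define A where "A j = p j * K ^ Suc j + (if j \<ge> 2 then coeff G (j - 2) * K ^ (j - 2) else 0)" for j
  have A_int: "A j \<in> \<int>" if "j < n" for j
  proof -
    have "(K * p j) * K ^ j \<in> \<int>" by (rule Ints_mult[OF p_int[OF that] Ints_power[OF K(1)]])
    then have 1: "p j * K ^ Suc j \<in> \<int>" by (simp add: mult_ac)
    have 2: "coeff G (j - 2) * K ^ (j - 2) \<in> \<int>"
    proof (cases "j - 2")
      case 0
      then show ?thesis using G0 by simp
    next
      case (Suc i)
      have "(K * coeff G (j - 2)) * K ^ i \<in> \<int>"
        by (rule Ints_mult[OF G_int Ints_power[OF K(1)]]) (use that in simp)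
      then show ?thesis using Suc by (simp add: mult_ac)
    qed
    show ?thesis unfolding A_def using 1 2 by auto
  qed
  have A_pos: "A j > 0" if "j < n" for j
  proof (cases "j \<ge> 2")
    case True
    then obtain i where i: "j = i + 2" by (metis add.commute le_Suc_ex)
    \<comment> \<open>the two summands differ by a factor of order \<open>K ^ 3\<close>, of which a single \<open>K\<close> is used\<close>
    have "K ^ 1 \<le> K ^ 3" using K(2) by (intro power_increasing) auto
    then have "K * p j \<le> K ^ 3 * p j" using p_pos[OF that] by (intro mult_right_mono) auto
    then have "K ^ 3 * p j + coeff G i > 0" using pos[OF that] by (simp add: i)
    then have "K ^ i * (K ^ 3 * p j + coeff G i) > 0" using K(2) by (intro mult_pos_pos) auto
    then show ?thesis by (simp add: A_def i algebra_simps power_add power3_eq_cube)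
  next
    case False
    then show ?thesis using p_pos[OF that] K(2) by (simp add: A_def)
  qed
  define y where "y = K / b"
  obtain m where m: "n = Suc (Suc m)" using n by (metis add_2_eq_Suc le_Suc_ex)
  have "(1 - y) * (1 - 2 * Re \<mu> * y + (norm \<mu>)\<^sup>2 * y\<^sup>2) =
      (b - K) * (b\<^sup>2 - K * (2 * Re \<mu>) * b + K\<^sup>2 * (norm \<mu>)\<^sup>2) / b ^ 3"
    using b(2) by (simp add: y_def field_simps power2_eq_square power3_eq_cube)
  then have y: "(1 - y) * (1 - 2 * Re \<mu> * y + (norm \<mu>)\<^sup>2 * y\<^sup>2) = 1 / b ^ 3" using b(1) by simp
  have "poly G y = (\<Sum>i<m. coeff G i * y ^ i)"
    unfolding poly_altdef using deg m by (intro sum.mono_neutral_left) (auto simp: coeff_eq_0)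
  then have "1 / b ^ 3 * poly G y = (\<Sum>i<m. coeff G i * K ^ i / b ^ (i + 3))"
    by (simp add: sum_distrib_left y_def power_divide power_add mult.commute)
  also have "\<dots> = (\<Sum>j<n. (if j \<ge> 2 then coeff G (j - 2) * K ^ (j - 2) else 0) / b ^ Suc j)"
    unfolding m sum.lessThan_Suc_shift by (simp add: eval_nat_numeral)
  finally have G_sum: "1 / b ^ 3 * poly G y = (\<Sum>j<n. (if j \<ge> 2 then coeff G (j - 2) * K ^ (j - 2) else 0) / b ^ Suc j)" .
  have "(\<Sum>j<n. A j / b ^ Suc j) = (\<Sum>j<n. p j * y ^ Suc j) + 1 / b ^ 3 * poly G y"
    unfolding G_sum sum.distrib[symmetric] by (intro sum.cong refl) (simp add: A_def y_def power_divide add_divide_distrib)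
  also have "\<dots> = 1" using id[of y] unfolding y by linarith
  finally have "b * (\<Sum>j<n. A j / b ^ Suc j) = b" by simp
  then have sum: "(\<Sum>j<n. A j / b ^ j) = b" using b(2) by (simp add: sum_distrib_left)
  have floor: "of_int \<lfloor>A j\<rfloor> = A j" if "j < n" for j
    using A_int[OF that] by (auto elim: Ints_cases)
  show ?thesis
  proof (intro exI[of _ "\<lambda>j. \<lfloor>A j\<rfloor>"] conjI allI impI)
    show "\<lfloor>A j\<rfloor> > 0" if "j < n" for j
      using A_pos[OF that] floor[OF that] by (metis of_int_0_less_iff)
    show "(\<Sum>j<n. of_int \<lfloor>A j\<rfloor> / b ^ j) = b"
      by (rule trans[OF sum.cong[OF refl] sum]) (simp only: floor lessThan_iff)
  qed
qed

section \<open>An aperiodic matrix from a renewal equation\<close>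

text \<open>Every index reaches the hub \<open>h\<close> within \<open>d i\<close> steps and may wait there, as the hub has a
  loop; one more step leads from the hub to any index.\<close>

lemma aperiodic_mat_hubI:
  fixes A :: "int mat" and d :: "nat \<Rightarrow> nat"
  assumes A: "A \<in> carrier_mat n n" and nn: "\<And>i j. i < n \<Longrightarrow> j < n \<Longrightarrow> A $$ (i, j) \<ge> 0"
    and h: "h < n" "d h = 0" and hub: "\<And>j. j < n \<Longrightarrow> A $$ (h, j) > 0"
    and descend: "\<And>i. i < n \<Longrightarrow> i \<noteq> h \<Longrightarrow> \<exists>j<n. d j < d i \<and> A $$ (i, j) > 0"
  shows "aperiodic_mat n A"
proof -
  have pow_nn: "(A ^\<^sub>m k) $$ (i, j) \<ge> 0" if "i < n" "j < n" for i j k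
    using pow_mat_nonneg[OF A nn] that by blast
  have reach: "(A ^\<^sub>m k) $$ (i, h) > 0" if "d i \<le> k" "i < n" for i k
    using that
  proof (induction k arbitrary: i)
    case 0
    then have "i = h" using descend[of i] by force
    then show ?case using h A by simp
  next
    case (Suc k)
    have "\<exists>j<n. A $$ (i, j) > 0 \<and> (A ^\<^sub>m k) $$ (j, h) > 0"
    proof (cases "i = h")
      case True
      then show ?thesis using Suc.IH[of h] h hub by auto
    next
      case False
      then obtain j where "j < n" "d j < d i" "A $$ (i, j) > 0" using descend Suc.prems by blast
      then show ?thesis using Suc by (metis leD leI less_Suc_eq_le order_less_le_trans)
    qed
    then obtain j where j: "j < n" "A $$ (i, j) > 0" "(A ^\<^sub>m k) $$ (j, h) > 0" by blast
    have "(A ^\<^sub>m Suc k) $$ (i, h) = (A * A ^\<^sub>m k) $$ (i, h)"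
      by (simp add: mult_pow_mat_commute[OF A])
    also have "\<dots> = (\<Sum>l<n. A $$ (i, l) * (A ^\<^sub>m k) $$ (l, h))"
      using A h Suc.prems by (intro mult_mat_entry) auto
    also have "\<dots> > 0" using j h nn pow_nn Suc.prems by (intro sum_pos2[of _ j]) auto
    finally show ?case .
  qed
  define k where "k = Max (d ` {..<n})"
  have pos: "(A ^\<^sub>m Suc k) $$ (i, j) > 0" if "i < n" "j < n" for i j
  proof -
    have "d i \<le> k" unfolding k_def using that by (intro Max_ge) auto
    have "(A ^\<^sub>m Suc k) $$ (i, j) = (\<Sum>l<n. (A ^\<^sub>m k) $$ (i, l) * A $$ (l, j))"
      unfolding pow_mat.simps using A that by (intro mult_mat_entry) auto
    also have "\<dots> > 0"
      using reach[OF \<open>d i \<le> k\<close> that(1)] hub[OF that(2)] h nn pow_nn that by (intro sum_pos2[of _ h]) auto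
    finally show ?thesis .
  qed
  show ?thesis unfolding aperiodic_mat_def using A nn pos by blast
qed

text \<open>For any other eigenvector \<open>v\<close> the comparison \<open>\<bar>v i\<bar> \<le> c * w i\<close> with the least possible \<open>c\<close> is an
  equality at some \<open>i\<close>; there the triangle inequality bounds the eigenvalue.\<close>

lemma spectral_radius_positive_eigenvector:
  fixes A :: "int mat" and w :: "nat \<Rightarrow> real"
  assumes A: "A \<in> carrier_mat n n" and n: "n > 0"
    and nn: "\<And>i j. i < n \<Longrightarrow> j < n \<Longrightarrow> A $$ (i, j) \<ge> 0"
    and w: "\<And>i. i < n \<Longrightarrow> w i > 0"
    and eq: "\<And>i. i < n \<Longrightarrow> (\<Sum>j<n. of_int (A $$ (i, j)) * w j) = q * w i"
  shows "spectral_radius (map_mat of_int A) = q"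
proof -
  have Ac: "map_mat of_int A \<in> carrier_mat n n" using A by simp
  have "0 \<le> q * w 0" unfolding eq[OF n, symmetric] using nn w n by (intro sum_nonneg mult_nonneg_nonneg) (auto simp: less_imp_le)
  then have q: "q \<ge> 0" using w[OF n] by (simp add: zero_le_mult_iff)
  have le: "norm \<nu> \<le> q" if \<nu>: "\<nu> \<in> spectrum (map_mat of_int A)" for \<nu> :: complex
  proof -
    obtain v where v: "v \<in> carrier_vec n" "v \<noteq> 0\<^sub>v n" "map_mat of_int A *\<^sub>v v = \<nu> \<cdot>\<^sub>v v"
      using \<nu> A unfolding spectrum_def eigenvalue_def eigenvector_def by auto
    define c where "c = Max ((\<lambda>i. norm (v $ i) / w i) ` {..<n})"
    have "c \<in> (\<lambda>i. norm (v $ i) / w i) ` {..<n}" unfolding c_def using n by (intro Max_in) auto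
    then obtain i where i: "i < n" "c = norm (v $ i) / w i" by auto
    have c: "norm (v $ j) \<le> c * w j" if "j < n" for j
    proof -
      have "norm (v $ j) / w j \<le> c" unfolding c_def using that by (intro Max_ge) auto
      then show ?thesis using w[OF that] by (simp add: field_simps)
    qed
    obtain l where l: "l < n" "v $ l \<noteq> 0" using v(1,2) by (force simp: vec_eq_iff)
    have "0 < norm (v $ l)" using l by simp
    also have "\<dots> \<le> c * w l" by (rule c[OF l(1)])
    finally have "c > 0" using w[OF l(1)] by (simp add: zero_less_mult_iff)
    then have vi: "norm (v $ i) > 0" using i w[OF i(1)] by (simp add: zero_less_divide_iff)
    have "norm \<nu> * norm (v $ i) = norm ((map_mat of_int A *\<^sub>v v) $ i)"
      using v i by (simp add: norm_mult)
    also have "(map_mat of_int A *\<^sub>v v) $ i = (\<Sum>j<n. of_int (A $$ (i, j)) * v $ j)"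
      using v(1) i A by (subst mult_mat_vec_entry[OF Ac]) auto
    also have "norm \<dots> \<le> (\<Sum>j<n. norm (of_int (A $$ (i, j)) * v $ j))" by (rule norm_sum)
    also have "\<dots> \<le> (\<Sum>j<n. of_int (A $$ (i, j)) * (c * w j))"
      using nn[OF i(1)] c unfolding norm_mult by (intro sum_mono mult_mono) auto
    also have "\<dots> = c * (q * w i)" unfolding eq[OF i(1), symmetric] by (simp add: sum_distrib_left mult_ac)
    also have "\<dots> = q * norm (v $ i)" using i w[OF i(1)] by simp
    finally show ?thesis using vi by simp
  qed
  have "complex_of_real q \<in> spectrum (map_mat of_int A)"
    using eigenvalue_of_positive_vector[OF A n w eq] by (simp add: spectrum_def)
  then have "q \<le> spectral_radius (map_mat of_int A)"
    using q by (intro spectral_radius_mem_max(2)[OF Ac n]) force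
  moreover have "spectral_radius (map_mat of_int A) \<le> q"
    using spectral_radius_mem_max(1)[OF Ac n] le by auto
  ultimately show ?thesis by simp
qed

text \<open>The matrix is the block matrix with rows \<open>(1, 1)\<close> and \<open>(B, 1 + B)\<close>, where \<open>B\<close> is the companion
  matrix with first row \<open>a\<close> and Perron vector \<open>v i = 1 / b ^ i\<close>. On vectors \<open>(v, (q - 1) v)\<close> the first row acts as
  \<open>q\<close>, and the second one does so because \<open>b * q + (q - 1) = q * (q - 1)\<close>. A companion matrix of \<open>q\<close> itself could not
  serve: a polynomial with one sign change has a single positive root, but if \<open>1 / q\<close> is a
  conjugate of \<open>q\<close>, then it is a second positive root.\<close>

lemma ex_aperiodic_mat_doubled_companion:
  fixes a :: "nat \<Rightarrow> int" and b q :: real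
  assumes n: "n > 0" and a: "\<And>j. j < n \<Longrightarrow> a j > 0" and b: "b > 0"
    and a_eq: "(\<Sum>j<n. of_int (a j) / b ^ j) = b"
    and q: "q > 1" "(q - 1)\<^sup>2 = b * q"
  shows "\<exists>A. aperiodic_mat (2 * n) A \<and> spectral_radius (map_mat of_int A) = q"
proof -
  define B where "B i j = (if i = 0 then a j else if i = Suc j then 1 else 0)" for i j
  define v where "v i = 1 / b ^ i" for i
  have B_nn: "B i j \<ge> 0" if "j < n" for i j using a[OF that] by (simp add: B_def)
  have Bv: "(\<Sum>j<n. of_int (B i j) * v j) = b * v i" if "i < n" for i
  proof (cases i)
    case 0
    then show ?thesis using a_eq by (simp add: B_def v_def)
  next
    case (Suc l)
    have "(\<Sum>j<n. of_int (B i j) * v j) = (\<Sum>j<n. if l = j then v j else 0)"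
      by (intro sum.cong) (auto simp: B_def Suc)
    also have "\<dots> = v l" using that Suc by (simp add: sum.delta')
    finally show ?thesis using b Suc by (simp add: v_def)
  qed
  define M where "M = mat (2 * n) (2 * n) (\<lambda>(i, j).
    if i < n then (if j = i \<or> j = i + n then 1 else 0)
    else B (i - n) (j mod n) + (if j = i then 1 else 0))"
  have M: "M \<in> carrier_mat (2 * n) (2 * n)" by (simp add: M_def)
  have M_nn: "M $$ (i, j) \<ge> 0" if "i < 2 * n" "j < 2 * n" for i j
    using that B_nn[of "j mod n" "i - n"] n by (simp add: M_def)
  have "aperiodic_mat (2 * n) M"
  \<comment> \<open>row \<open>n\<close> contains the first row of \<open>B\<close> twice and is positive; from \<open>i < n\<close> the matrix leads to \<open>i + n\<close>, and from there down to \<open>n\<close> one by one\<close>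
  proof (rule aperiodic_mat_hubI[OF M M_nn, where h = n and d = "\<lambda>i. if i < n then Suc i else i - n"])
    show "M $$ (n, j) > 0" if "j < 2 * n" for j
      using that a[of "j mod n"] n by (auto simp: M_def B_def intro: add_pos_nonneg)
    fix i assume i: "i < 2 * n" "i \<noteq> n"
    show "\<exists>j<2 * n. (if j < n then Suc j else j - n) < (if i < n then Suc i else i - n) \<and> 0 < M $$ (i, j)"
    proof (cases "i < n")
      case True
      then show ?thesis by (intro exI[of _ "i + n"]) (auto simp: M_def)
    next
      case False
      then have "(i - 1) mod n = i - 1 - n" using i by (simp add: mod_if)
      then show ?thesis using False i by (intro exI[of _ "i - 1"]) (auto simp: M_def B_def)
    qed
  qed (use n in auto)
  moreover have "spectral_radius (map_mat of_int M) = q"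
  proof (rule spectral_radius_positive_eigenvector[OF M _ M_nn, where w = "\<lambda>i. if i < n then v i else (q - 1) * v (i - n)"])
    show "0 < (if i < n then v i else (q - 1) * v (i - n))" for i using q b by (simp add: v_def)
    fix i assume i: "i < 2 * n"
    have split: "(\<Sum>j<2 * n. f j) = (\<Sum>j<n. f j) + (\<Sum>j<n. f (j + n))" for f :: "nat \<Rightarrow> real"
      using sum.nat_group[of f n 2] sum.shift_bounds_nat_ivl[of f 0 n n]
      by (simp add: numeral_2_eq_2 atLeast0LessThan add.commute)
    show "(\<Sum>j<2 * n. of_int (M $$ (i, j)) * (if j < n then v j else (q - 1) * v (j - n))) =
      q * (if i < n then v i else (q - 1) * v (i - n))"
    proof (cases "i < n")
      case True
      have "(\<Sum>j<2 * n. of_int (M $$ (i, j)) * (if j < n then v j else (q - 1) * v (j - n))) =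
          (\<Sum>j<n. if i = j then v j else 0) + (\<Sum>j<n. if i = j then (q - 1) * v j else 0)"
        unfolding split using True i by (intro arg_cong2[of _ _ _ _ "(+)"] sum.cong) (auto simp: M_def)
      then show ?thesis using True by (simp add: sum.delta' algebra_simps)
    next
      case False
      define l where "l = i - n"
      have l: "l < n" "i = l + n" using False i by (auto simp: l_def)
      have "(\<Sum>j<2 * n. of_int (M $$ (i, j)) * (if j < n then v j else (q - 1) * v (j - n))) =
          (\<Sum>j<n. of_int (B l j) * v j) +
          (\<Sum>j<n. (q - 1) * (of_int (B l j) * v j) + (if l = j then (q - 1) * v j else 0))"
        unfolding split using l i by (intro arg_cong2[of _ _ _ _ "(+)"] sum.cong) (auto simp: M_def algebra_simps)
      also have "\<dots> = b * v l + (q - 1) * (b * v l) + (q - 1) * v l"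
        using l by (simp add: Bv sum.distrib sum.delta' flip: sum_distrib_left)
      also have "\<dots> = (b * q + (q - 1)) * v l" by (simp add: algebra_simps)
      also have "\<dots> = q * ((q - 1) * v l)" unfolding q(2)[symmetric] by (simp add: algebra_simps power2_eq_square)
      finally show ?thesis using False by (simp add: l_def)
    qed
  qed (use n in auto)
  ultimately show ?thesis by blast
qed

section \<open>Reciprocal sextic units from a perturbed cubic\<close>

text \<open>The three factors \<open>x - K\<close>, \<open>x - K * \<mu>\<close>, \<open>x - K * cnj \<mu>\<close> have product \<open>1\<close>, so one of them has modulus at
  most \<open>1\<close>. There is one real root, as the cubic increases beyond \<open>K\<close> and is negative before it. A
  nonreal root and its conjugate have the sum \<open>K + 2 * K * Re \<mu> - b\<close>, so their real part is less than \<open>K * Re \<mu>\<close>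
  and they are not the ones near \<open>K\<close>.\<close>

lemma perturbed_cubic_roots:
  fixes K :: real and \<mu> :: complex
  assumes K: "K > 0" "K * Im \<mu> > 1" "K * (1 - norm \<mu>) > 1"
  shows "\<exists>b. K < b \<and> b < K + 1 \<and> (b - K) * (b\<^sup>2 - K * (2 * Re \<mu>) * b + K\<^sup>2 * (norm \<mu>)\<^sup>2) = 1 \<and>
    (\<forall>x :: complex. (x - of_real K) * (x\<^sup>2 - of_real (K * (2 * Re \<mu>)) * x + of_real (K\<^sup>2 * (norm \<mu>)\<^sup>2)) = 1 \<longrightarrow>
      x = of_real b \<or> norm x < K \<and> (norm (x - of_real K * \<mu>) \<le> 1 \<or> norm (x - of_real K * cnj \<mu>) \<le> 1))"
proof -
  define h where "h x = (x - K * Re \<mu>)\<^sup>2 + (K * Im \<mu>)\<^sup>2" for x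
  have h_eq: "x\<^sup>2 - K * (2 * Re \<mu>) * x + K\<^sup>2 * (norm \<mu>)\<^sup>2 = h x" for x
    unfolding h_def cmod_power2 by (simp add: power2_eq_square algebra_simps)
  have "1 < (K * Im \<mu>)\<^sup>2" using K(2) by (intro one_less_power) auto
  then have h_gt: "h x > 1" for x unfolding h_def using zero_le_power2[of "x - K * Re \<mu>"] by linarith
  have "\<exists>b\<ge>K. b \<le> K + 1 \<and> (b - K) * h b = 1"
    using h_gt[of "K + 1"] by (intro IVT') (auto simp: h_def intro!: continuous_intros)
  then obtain b where b: "K \<le> b" "b \<le> K + 1" "(b - K) * h b = 1" by blast
  have "b \<noteq> K" using b(3) by auto
  moreover have "b \<noteq> K + 1" using b(3) h_gt[of b] by auto
  ultimately have b_bounds: "K < b" "b < K + 1" using b by auto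
  have "Re \<mu> \<le> norm \<mu>" using complex_Re_le_cmod by blast
  then have "K * (1 - norm \<mu>) \<le> K * (1 - Re \<mu>)" using K(1) by (intro mult_left_mono) auto
  then have K_Re: "K * (1 - Re \<mu>) > 1" using K(3) by linarith
  have mono: "(r - K) * h r < (s - K) * h s" if "K < r" "r < s" for r s
  proof -
    have "K * Re \<mu> < K" using K_Re by (simp add: algebra_simps)
    then have "h r \<le> h s" unfolding h_def using that by (intro add_right_mono power_mono) auto
    then have "(r - K) * h r \<le> (r - K) * h s" using that by (intro mult_left_mono) auto
    also have "\<dots> < (s - K) * h s" using that h_gt[of s] by (intro mult_strict_right_mono) auto
    finally show ?thesis .
  qed
  have roots: "x = of_real b \<or> norm x < K \<and> (norm (x - of_real K * \<mu>) \<le> 1 \<or> norm (x - of_real K * cnj \<mu>) \<le> 1)"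
    if x: "(x - of_real K) * (x\<^sup>2 - of_real (K * (2 * Re \<mu>)) * x + of_real (K\<^sup>2 * (norm \<mu>)\<^sup>2)) = 1" for x :: complex
  proof (cases "Im x = 0")
    case True
    define r where "r = Re x"
    have x_r: "x = of_real r" using True by (simp add: r_def complex_eq_iff)
    have "of_real ((r - K) * (r\<^sup>2 - K * (2 * Re \<mu>) * r + K\<^sup>2 * (norm \<mu>)\<^sup>2)) = complex_of_real 1"
      using x unfolding x_r by simp
    then have r: "(r - K) * h r = 1" unfolding h_eq of_real_eq_iff .
    then have "(r - K) * h r > 0" by simp
    then have "r > K" using h_gt[of r] by (simp add: zero_less_mult_iff)
    then have "r = b" using mono[of r b] mono[of b r] r b(3) b_bounds by (cases r b rule: linorder_cases) auto
    then show ?thesis using x_r by simp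
  next
    case False
    \<comment> \<open>dividing the cubic by \<open>x - b\<close> leaves a real quadratic, whose imaginary part gives \<open>Re x\<close>\<close>
    define S P where "S = K + K * (2 * Re \<mu>)" and "P = K * (K * (2 * Re \<mu>)) + K\<^sup>2 * (norm \<mu>)\<^sup>2"
    have b': "(b - K) * (b\<^sup>2 - K * (2 * Re \<mu>) * b + K\<^sup>2 * (norm \<mu>)\<^sup>2) = 1" using b(3) h_eq by simp
    have "(of_real b - of_real K) * ((of_real b)\<^sup>2 - of_real (K * (2 * Re \<mu>)) * of_real b + of_real (K\<^sup>2 * (norm \<mu>)\<^sup>2)) = complex_of_real 1"
      unfolding b'[symmetric] by simp
    then have "(x - of_real b) * (x\<^sup>2 + of_real (b - S) * x + of_real (b\<^sup>2 - S * b + P)) = 0"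
      using x unfolding S_def P_def by (simp add: algebra_simps power2_eq_square power3_eq_cube)
    moreover have "x \<noteq> of_real b" using False by auto
    ultimately have "x\<^sup>2 + of_real (b - S) * x + of_real (b\<^sup>2 - S * b + P) = 0" by simp
    then have "Im (x\<^sup>2 + of_real (b - S) * x + of_real (b\<^sup>2 - S * b + P)) = 0" by simp
    then have "Im x * (2 * Re x + (b - S)) = 0" by (simp add: power2_eq_square algebra_simps)
    then have "2 * Re x = S - b" using False by simp
    then have Re_x: "Re x < K * Re \<mu>" using b_bounds by (simp add: S_def)
    have "K - Re x \<le> norm (x - of_real K)" using abs_Re_le_cmod[of "x - of_real K"] by simp
    then have far: "norm (x - of_real K) > 1" using Re_x K_Re by (simp add: algebra_simps)
    have "x\<^sup>2 - of_real (K * (2 * Re \<mu>)) * x + of_real (K\<^sup>2 * (norm \<mu>)\<^sup>2) =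
        x\<^sup>2 - of_real K * (\<mu> + cnj \<mu>) * x + (of_real K)\<^sup>2 * (\<mu> * cnj \<mu>)"
      unfolding complex_add_cnj complex_norm_square[symmetric] by simp
    also have "\<dots> = (x - of_real K * \<mu>) * (x - of_real K * cnj \<mu>)"
      by (simp add: algebra_simps power2_eq_square)
    finally have "(x - of_real K) * ((x - of_real K * \<mu>) * (x - of_real K * cnj \<mu>)) = 1" using x by simp
    then have prod: "norm (x - of_real K) * (norm (x - of_real K * \<mu>) * norm (x - of_real K * cnj \<mu>)) = 1"
      by (simp flip: norm_mult)
    have near: "norm (x - of_real K * \<mu>) \<le> 1 \<or> norm (x - of_real K * cnj \<mu>) \<le> 1"
    proof (rule ccontr)
      assume "\<not> ?thesis"
      then have "norm (x - of_real K * \<mu>) * norm (x - of_real K * cnj \<mu>) > 1"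
        by (intro less_1_mult) auto
      then have "norm (x - of_real K) * (norm (x - of_real K * \<mu>) * norm (x - of_real K * cnj \<mu>)) > 1"
        using far by (rule less_1_mult[rotated])
      then show False using prod by simp
    qed
    have "norm x \<le> K * norm \<mu> + 1"
      using near
    proof
      assume "norm (x - of_real K * \<mu>) \<le> 1"
      then show ?thesis using norm_triangle_sub[of x "of_real K * \<mu>"] K(1) by (simp add: norm_mult)
    next
      assume "norm (x - of_real K * cnj \<mu>) \<le> 1"
      then show ?thesis using norm_triangle_sub[of x "of_real K * cnj \<mu>"] K(1) by (simp add: norm_mult)
    qed
    then have "norm x < K" using K(3) by (simp add: algebra_simps)
    then show ?thesis using near by blast
  qed
  show ?thesis using b_bounds b(3) roots unfolding h_eq by blast
qed

lemma ex_reciprocal_shift: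
  fixes b :: real
  assumes "b > 0"
  shows "\<exists>q>1. (q - 1)\<^sup>2 = b * q \<and> b + 1 < q \<and> q < b + 2"
proof -
  have "\<exists>q\<ge>b + 1. q \<le> b + 2 \<and> (q - 1)\<^sup>2 - b * q = 0"
    using assms by (intro IVT') (auto simp: power2_eq_square algebra_simps intro!: continuous_intros)
  then obtain q where q: "q \<ge> b + 1" "q \<le> b + 2" "(q - 1)\<^sup>2 - b * q = 0" by blast
  moreover have "q \<noteq> b + 1" "q \<noteq> b + 2" using q(3) assms by (auto simp: power2_eq_square algebra_simps)
  ultimately show ?thesis using assms by (intro exI[of _ q]) auto
qed

text \<open>The polynomial \<open>z\<^sup>3 ((x - K) * (x\<^sup>2 - T * x + M) - 1)\<close> for \<open>x = z + 1 / z - 2 = (z - 1)\<^sup>2 / z\<close>, in expanded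
  form.\<close>

definition reciprocal_sextic :: "int \<Rightarrow> int \<Rightarrow> int \<Rightarrow> int poly" where
  "reciprocal_sextic K T M =
    (let c1 = - (6 + T + K); c2 = 7 + 2 * T + M + (2 + K) * (4 + T);
         c3 = - 2 * (4 + T) - (2 + K) * (6 + 2 * T + M) - 1
     in [:1, c1, c2, c3, c2, c1, 1:])"

lemma reciprocal_sextic_coeffs:
  "lead_coeff (reciprocal_sextic K T M) = 1" "coeff (reciprocal_sextic K T M) 0 = 1"
  "degree (reciprocal_sextic K T M) = 6"
  by (simp_all add: reciprocal_sextic_def Let_def)

lemma poly_reciprocal_sextic:
  "poly (of_int_poly (reciprocal_sextic K T M)) (z :: complex) =
    ((z - 1)\<^sup>2 - of_int K * z) * (((z - 1)\<^sup>2)\<^sup>2 - of_int T * ((z - 1)\<^sup>2 * z) + of_int M * z\<^sup>2) - z ^ 3"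
  by (simp add: reciprocal_sextic_def Let_def algebra_simps power2_eq_square power3_eq_cube)

lemma reciprocal_sextic_root:
  fixes z :: complex
  assumes "poly (of_int_poly (reciprocal_sextic K T M)) z = 0"
  defines "x \<equiv> (z - 1)\<^sup>2 / z"
  shows "z \<noteq> 0" "(x - of_int K) * (x\<^sup>2 - of_int T * x + of_int M) = 1"
proof -
  show z: "z \<noteq> 0"
  proof
    assume "z = 0"
    then show False using assms(1) poly_reciprocal_sextic[of K T M 0] by simp
  qed
  have x: "x * z = (z - 1)\<^sup>2" using z by (simp add: x_def)
  have "((x - of_int K) * (x\<^sup>2 - of_int T * x + of_int M)) * z ^ 3 =
     (x * z - of_int K * z) * ((x * z)\<^sup>2 - of_int T * ((x * z) * z) + of_int M * z\<^sup>2)"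
    by (simp add: algebra_simps power2_eq_square power3_eq_cube)
  also have "\<dots> = z ^ 3"
    using assms(1) unfolding poly_reciprocal_sextic x by simp
  finally show "(x - of_int K) * (x\<^sup>2 - of_int T * x + of_int M) = 1" using z by simp
qed

lemma reciprocal_sextic_rootI:
  fixes q b :: real
  assumes q: "(q - 1)\<^sup>2 = b * q" and b: "(b - of_int K) * (b\<^sup>2 - of_int T * b + of_int M) = 1"
  shows "poly (of_int_poly (reciprocal_sextic K T M)) (complex_of_real q) = 0"
proof -
  have "((q - 1)\<^sup>2 - of_int K * q) * (((q - 1)\<^sup>2)\<^sup>2 - of_int T * ((q - 1)\<^sup>2 * q) + of_int M * q\<^sup>2) - q ^ 3
    = ((b - of_int K) * (b\<^sup>2 - of_int T * b + of_int M)) * q ^ 3 - q ^ 3"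
    unfolding q by (simp add: algebra_simps power2_eq_square power3_eq_cube)
  also have "\<dots> = 0" unfolding b by simp
  finally have "complex_of_real (((q - 1)\<^sup>2 - of_int K * q) * (((q - 1)\<^sup>2)\<^sup>2 - of_int T * ((q - 1)\<^sup>2 * q) + of_int M * q\<^sup>2) - q ^ 3) = 0"
    by simp
  then show ?thesis unfolding poly_reciprocal_sextic by simp
qed

text \<open>A rational algebraic integer is an integer, and none lies strictly between \<open>K\<close> and \<open>K + 1\<close>.\<close>

lemma perturbed_cubic_root_irrational:
  fixes b :: real
  assumes b: "(b - of_int K) * (b\<^sup>2 - of_int T * b + of_int M) = 1" "of_int K < b" "b < of_int K + 1"
  shows "complex_of_real b \<notin> \<rat>"
proof
  assume rat: "complex_of_real b \<in> \<rat>"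
  define P :: "int poly" where "P = [:- (K * M) - 1, M + K * T, - (K + T), 1:]"
  have "complex_of_real ((b - of_int K) * (b\<^sup>2 - of_int T * b + of_int M)) = 1" using b(1) by simp
  then have "poly (of_int_poly P) (complex_of_real b) = 0"
    by (simp add: P_def algebra_simps power2_eq_square)
  moreover have "lead_coeff P = 1" by (simp add: P_def)
  ultimately have "algebraic_int (complex_of_real b)" unfolding algebraic_int_altdef_ipoly by blast
  then have "complex_of_real b \<in> \<int>" using rat rational_algebraic_int_is_int by blast
  then obtain n where "complex_of_real b = of_int n" by (elim Ints_cases)
  then have "b = of_int n" by (metis of_real_eq_iff of_real_of_int_eq)
  then have "of_int K < real_of_int n" "real_of_int n < of_int (K + 1)" using b(2,3) by simp_all
  then show False unfolding of_int_less_iff by simp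
qed

lemma reciprocal_shift_roots:
  fixes z :: complex and q :: real
  assumes "q > 0" "(q - 1)\<^sup>2 = b * q" "z \<noteq> 0" "(z - 1)\<^sup>2 / z = of_real b"
  shows "z = of_real q \<or> z = of_real (inverse q)"
proof -
  have "b = q + inverse q - 2" using assms(1,2) by (simp add: field_simps power2_eq_square)
  then have b: "complex_of_real b = of_real q + of_real (inverse q) - 2" by simp
  have qq: "complex_of_real q * of_real (inverse q) = 1"
    using assms(1) by (simp flip: of_real_mult)
  have "(z - of_real q) * (z - of_real (inverse q)) =
      z\<^sup>2 - (of_real q + of_real (inverse q)) * z + of_real q * of_real (inverse q)"
    by (simp only: power2_eq_square ring_distribs minus_mult_left[symmetric]) (simp add: mult.commute)
  also have "\<dots> = (z - 1)\<^sup>2 - of_real b * z"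
    unfolding qq b by (simp add: power2_eq_square algebra_simps)
  also have "\<dots> = 0" using assms(3,4) by (simp add: field_simps)
  finally show ?thesis by simp
qed

text \<open>With \<open>r = \<bar>z\<bar>\<close>, the estimate \<open>(r - 1)\<^sup>2 \<le> \<bar>z - 1\<bar>\<^sup>2 < b * r\<close> amounts to
  \<open>(r - q) * (r - 1 / q) < 0\<close>.\<close>

lemma reciprocal_shift_annulus:
  fixes z :: complex and q :: real
  assumes q: "q > 1" "(q - 1)\<^sup>2 = b * q" and z: "z \<noteq> 0" "norm ((z - 1)\<^sup>2 / z) < b"
  shows "inverse q < norm z" "norm z < q"
proof -
  define r where "r = norm z"
  have r: "r > 0" using z(1) by (simp add: r_def)
  have b: "b = q + inverse q - 2" using q by (simp add: field_simps power2_eq_square)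
  have "\<bar>r - 1\<bar> \<le> norm (z - 1)" using norm_triangle_ineq3[of z 1] by (simp add: r_def)
  then have "(r - 1)\<^sup>2 \<le> (norm (z - 1))\<^sup>2" by (metis abs_ge_zero power2_abs power_mono)
  also have "(norm (z - 1))\<^sup>2 < b * r"
    using z r by (simp add: norm_divide norm_power r_def field_simps)
  finally have "(r - q) * (r - inverse q) < 0"
    using q by (simp add: b algebra_simps power2_eq_square)
  moreover have "inverse q < q" using q(1) inverse_less_1_iff[of q] by linarith
  ultimately show "inverse q < norm z" "norm z < q"
    unfolding r_def[symmetric] by (auto simp: mult_less_0_iff)
qed

text \<open>Every conjugate \<open>z\<close> of \<open>q\<close> gives a root \<open>X z = (z - 1)\<^sup>2 / z\<close> of the cubic. Those over \<open>b\<close> are \<open>q\<close> and possibly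
  \<open>1 / q\<close>; all others satisfy \<open>\<bar>X z\<bar> < K < b\<close> and lie in the required annulus. As \<open>b\<close> is irrational, some
  conjugate lies over a nonreal root. It need not have modulus at least \<open>1\<close>, since
  \<open>1 / z\<close> gives the same \<open>X z\<close>; but if all such conjugates were inside the unit disk, two of them would have
  modulus of order \<open>1 / K\<close>, and the norm of \<open>q\<close> would have absolute value less than \<open>1\<close>.\<close>

lemma biPerron_of_perturbed_cubic:
  fixes K T M :: int and \<mu> :: complex
  assumes T: "of_int T = of_int K * (2 * Re \<mu>)" and M: "of_int M = (of_int K)\<^sup>2 * (norm \<mu>)\<^sup>2"
    and K: "K > 0" "of_int K * Im \<mu> > 1" "of_int K * (1 - norm \<mu>) > 1"
      "of_int K * norm \<mu> > 4" "of_int K + 3 < (of_int K * norm \<mu> - 4)\<^sup>2"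
  shows "\<exists>b q. of_int K < b \<and> b < of_int K + 1 \<and>
    (b - of_int K) * (b\<^sup>2 - of_int T * b + of_int M) = 1 \<and>
    b + 1 < q \<and> q < b + 2 \<and> (q - 1)\<^sup>2 = b * q \<and> biPerron q \<and> algebraic_degree (of_real q) \<le> 6 \<and>
    algebraic (complex_of_real q) \<and>
    (\<exists>z\<in>galois_conjugates (of_real q). norm (z - of_int K * \<mu>) \<le> 4)"
proof -
  define k where "k = real_of_int K"
  have k0: "k > 0" using K(1) by (simp add: k_def)
  obtain b where b: "k < b" "b < k + 1" "(b - k) * (b\<^sup>2 - of_int T * b + of_int M) = 1"
    and roots: "\<And>x :: complex. (x - of_int K) * (x\<^sup>2 - of_int T * x + of_int M) = 1 \<Longrightarrow>
      x = of_real b \<or> norm x < k \<and> (norm (x - of_int K * \<mu>) \<le> 1 \<or> norm (x - of_int K * cnj \<mu>) \<le> 1)"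
    using perturbed_cubic_roots[of k \<mu>] k0 K T[symmetric] M[symmetric] unfolding k_def by auto
  obtain q where q: "q > 1" "(q - 1)\<^sup>2 = b * q" "b + 1 < q" "q < b + 2"
    using ex_reciprocal_shift[of b] b k0 by auto
  define S where "S = reciprocal_sextic K T M"
  have S_q: "poly (of_int_poly S) (complex_of_real q) = 0"
    unfolding S_def by (rule reciprocal_sextic_rootI[OF q(2)]) (use b(3) in \<open>simp add: k_def\<close>)
  have S_coeffs: "lead_coeff S = 1" "coeff S 0 = 1" "degree S = 6"
    unfolding S_def by (rule reciprocal_sextic_coeffs)+
  have unit: "unit_algebraic_int (of_real q)"
    by (rule unit_algebraic_intI[OF S_coeffs(1) _ S_q]) (simp add: S_coeffs)
  then have alg: "algebraic (complex_of_real q)" by (auto simp: unit_algebraic_int_def)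
  define C where "C = galois_conjugates (complex_of_real q)"
  have q_C: "of_real q \<in> C" unfolding C_def by (rule self_mem_galois_conjugates[OF alg])
  have fin: "finite C" unfolding C_def by (rule min_poly_rat_factorization(1)[OF alg])
  define X where "X z = (z - 1)\<^sup>2 / z" for z :: complex
  have C_root: "z \<noteq> 0" "X z = of_real b \<or> norm (X z) < k \<and>
      (norm (X z - of_int K * \<mu>) \<le> 1 \<or> norm (X z - of_int K * cnj \<mu>) \<le> 1)" if "z \<in> C" for z
  proof -
    have "poly (of_int_poly S) z = 0"
      using galois_conjugates_root_int[OF alg S_q] that by (simp add: C_def)
    then show "z \<noteq> 0" "X z = of_real b \<or> norm (X z) < k \<and>
      (norm (X z - of_int K * \<mu>) \<le> 1 \<or> norm (X z - of_int K * cnj \<mu>) \<le> 1)"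
      unfolding S_def X_def using reciprocal_sextic_root roots by blast+
  qed
  have X_b: "z = of_real q \<or> z = of_real (inverse q)" if "z \<in> C" "X z = of_real b" for z
    using reciprocal_shift_roots[OF _ q(2) C_root(1)[OF that(1)]] that(2) q(1) by (simp add: X_def)

  have "degree (min_poly_rat (of_real q)) \<le> degree (of_int_poly S :: rat poly)"
  proof (rule dvd_imp_degree_le)
    show "min_poly_rat (of_real q) dvd of_int_poly S"
      using irreducible_common_root_dvd min_poly_rat[OF alg] S_q map_poly_of_rat_of_int by metis
    have "degree (of_int_poly S :: rat poly) = 6" by (simp add: S_coeffs)
    then show "of_int_poly S \<noteq> (0 :: rat poly)" by auto
  qed
  then have deg: "algebraic_degree (of_real q) \<le> 6"
    by (simp add: algebraic_degree_def S_coeffs)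

  have "biPerron q"
    unfolding biPerron_def
  proof (intro conjI ballI unit q(1))
    fix z assume z: "z \<in> galois_conjugates (of_real q) - {of_real q, of_real (inverse q)}"
    then have "z \<in> C" by (simp add: C_def)
    then have "norm (X z) < b" using X_b C_root(2) z b by fastforce
    then have "inverse q < norm z" "norm z < q"
      unfolding X_def by (rule reciprocal_shift_annulus[OF q(1,2) C_root(1)[OF \<open>z \<in> C\<close>]])+
    then show "1 / q < norm z" "norm z < q" by (simp_all add: inverse_eq_divide)
  qed

  have "\<exists>z\<in>C. X z \<noteq> of_real b"
  proof (rule ccontr)
    assume "\<not> ?thesis"
    then have "C \<subseteq> {of_real q, inverse (of_real q)}" using X_b by (force simp: of_real_inverse)
    moreover have "complex_of_real q \<noteq> inverse (of_real q)"
    proof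
      assume "complex_of_real q = inverse (of_real q)"
      then have "q = inverse q" unfolding of_real_inverse[symmetric] of_real_eq_iff .
      moreover have "inverse q < 1" using q(1) by (simp add: inverse_less_1_iff)
      ultimately show False using q(1) by simp
    qed
    ultimately have "complex_of_real q + inverse (of_real q) \<in> \<rat>"
      using q(1) by (intro rational_trace_of_reciprocal_pair[OF alg]) (auto simp: C_def)
    moreover have "b = q + inverse q - 2" using q(1,2) by (simp add: field_simps power2_eq_square)
    then have "complex_of_real b = complex_of_real q + inverse (of_real q) - 2" by simp
    ultimately have "complex_of_real b \<in> \<rat>" by simp
    then show False using perturbed_cubic_root_irrational[of b K T M] b by (simp add: k_def)
  qed
  then obtain z0 where z0: "z0 \<in> C" "X z0 \<noteq> of_real b" by blast
  have big_X: "norm (X z) \<ge> k * norm \<mu> - 1" if "norm (X z - of_int K * \<mu>) \<le> 1 \<or> norm (X z - of_int K * cnj \<mu>) \<le> 1" for z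
    using that norm_triangle_ineq3[of "X z" "of_int K * \<mu>"] norm_triangle_ineq3[of "X z" "of_int K * cnj \<mu>"] k0
    by (auto simp: norm_mult k_def)
  have X_eq: "X z = z - 2 + inverse z" if "z \<noteq> 0" for z
  proof -
    have "(z - 1)\<^sup>2 = (z - 2 + inverse z) * z" using that by (simp add: power2_eq_square algebra_simps)
    then show ?thesis using that by (simp add: X_def)
  qed

  have "\<exists>z\<in>C. X z \<noteq> of_real b \<and> norm z \<ge> 1"
  proof (rule ccontr)
    assume neg: "\<not> ?thesis"
    have z0_nz: "z0 \<noteq> 0" and z0_lt: "norm z0 < 1" using C_root(1) z0 neg by force+
    have near: "norm (X z0 - of_int K * \<mu>) \<le> 1 \<or> norm (X z0 - of_int K * cnj \<mu>) \<le> 1"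
      using C_root(2)[OF z0(1)] z0(2) by blast
    have "Im z0 \<noteq> 0"
    proof
      assume "Im z0 = 0"
      then have "Im (X z0) = 0" using X_eq[OF z0_nz] by simp
      then show False
        using near abs_Im_le_cmod[of "X z0 - of_int K * \<mu>"] abs_Im_le_cmod[of "X z0 - of_int K * cnj \<mu>"] K(2)
        by (auto simp: k_def)
    qed
    then have distinct: "cnj z0 \<noteq> z0" "z0 \<noteq> of_real q" "cnj z0 \<noteq> of_real q"
      by (auto simp: complex_eq_iff)
    have le1: "norm z \<le> 1" if "z \<in> C" "z \<noteq> of_real q" for z
    proof (cases "X z = of_real b")
      case True
      then have "z = of_real (inverse q)" using X_b that by blast
      then show ?thesis using q(1) by (simp add: norm_inverse inverse_le_1_iff)
    next
      case False
      then show ?thesis using neg that by force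
    qed
    \<comment> \<open>the norm of \<open>q\<close> splits into \<open>q\<close>, the pair \<open>z0\<close>, \<open>cnj z0\<close>, and factors of modulus at most \<open>1\<close>\<close>
    define R where "R = C - {of_real q, z0, cnj z0}"
    have "C = insert (of_real q) (insert z0 (insert (cnj z0) R))"
      using q_C z0(1) galois_conjugates_cnj[of z0 "of_real q"] by (auto simp: R_def C_def)
    then have "norm (\<Prod>z\<in>C. z) = norm (\<Prod>z\<in>insert (of_real q) (insert z0 (insert (cnj z0) R)). z)" by simp
    also have "\<dots> = q * (norm z0)\<^sup>2 * (\<Prod>z\<in>R. norm z)"
      using distinct fin q(1) by (simp add: R_def norm_mult prod_norm power2_eq_square)
    also have "\<dots> \<le> q * (norm z0)\<^sup>2 * 1"
      using le1 q(1) by (intro mult_left_mono prod_le_1) (auto simp: R_def)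
    finally have "norm (\<Prod>z\<in>C. z) \<le> q * (norm z0)\<^sup>2" by simp
    moreover have "norm (\<Prod>z\<in>C. z) = 1"
      using unit by (auto simp: unit_algebraic_int_def C_def)
    ultimately have ge: "1 \<le> q * (norm z0)\<^sup>2" by simp
    have "k * norm \<mu> - 1 \<le> norm (z0 - 2 + inverse z0)" using big_X[OF near] X_eq[OF z0_nz] by simp
    also have "\<dots> \<le> norm z0 + 2 + inverse (norm z0)"
      using norm_triangle_ineq[of "z0 - 2" "inverse z0"] norm_triangle_ineq4[of z0 2] by (simp add: norm_inverse)
    finally have inv: "k * norm \<mu> - 4 \<le> inverse (norm z0)" using z0_lt by simp
    have "(k * norm \<mu> - 4)\<^sup>2 \<le> (inverse (norm z0))\<^sup>2"
      using inv K(4) by (intro power_mono) (auto simp: k_def)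
    also have "\<dots> \<le> q" using ge z0_nz by (simp add: field_simps power2_eq_square)
    finally show False using K(5) q(4) b(2) by (simp add: k_def)
  qed
  then obtain z where z: "z \<in> C" "X z \<noteq> of_real b" "norm z \<ge> 1" by blast
  have "z - X z = 2 - inverse z" using X_eq[OF C_root(1)[OF z(1)]] by simp
  moreover have "norm (2 - inverse z) \<le> 2 + 1"
    using norm_triangle_ineq4[of 2 "inverse z"] z(3) inverse_le_1_iff[of "norm z"]
    by (simp add: norm_inverse)
  ultimately have z_X: "norm (z - X z) \<le> 3" by simp
  have "\<exists>z\<in>C. norm (z - of_int K * \<mu>) \<le> 4"
  proof (cases "norm (X z - of_int K * \<mu>) \<le> 1")
    case True
    then show ?thesis using z_X norm_triangle_ineq[of "z - X z" "X z - of_int K * \<mu>"] z(1) by force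
  next
    case False
    then have "norm (X z - of_int K * cnj \<mu>) \<le> 1" using C_root(2)[OF z(1)] z(2) by blast
    then have "norm (z - of_int K * cnj \<mu>) \<le> 4"
      using z_X norm_triangle_ineq[of "z - X z" "X z - of_int K * cnj \<mu>"] by simp
    then have "norm (cnj (z - of_int K * cnj \<mu>)) \<le> 4" by (simp only: complex_mod_cnj)
    then show ?thesis using galois_conjugates_cnj[of z "of_real q"] z(1)
      by (intro bexI[of _ "cnj z"]) (auto simp: C_def)
  qed
  then show ?thesis using b q deg alg \<open>biPerron q\<close> unfolding k_def C_def by blast
qed

section \<open>Large Perron-Frobenius degree\<close>

text \<open>The existence of some matrix ensures that the least size is attained by a matrix, to which the
  recurrence of eigenvalue ratios applies.\<close>

lemma perron_frobenius_degree_gt: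
  assumes ex: "\<exists>A. aperiodic_mat m A \<and> spectral_radius (map_mat of_int A) = q" "m > 0"
    and q: "q > 0" "algebraic (complex_of_real q)" and z: "z \<in> galois_conjugates (of_real q)"
    and spiral: "z / of_real q \<in> spiral_params N"
  shows "perron_frobenius_degree q > N"
proof (rule ccontr)
  assume le: "\<not> perron_frobenius_degree q > N"
  define n where "n = perron_frobenius_degree q"
  have "n > 0 \<and> (\<exists>A. aperiodic_mat n A \<and> spectral_radius (map_mat of_int A) = q)"
    unfolding n_def perron_frobenius_degree_def by (rule LeastI[of _ m]) (use ex in auto)
  then obtain A where n: "n > 0" and A: "aperiodic_mat n A" "spectral_radius (map_mat of_int A) = q" by blast
  have "n \<le> N" using le by (simp add: n_def)
  have A_carrier: "A \<in> carrier_mat n n" "map_mat of_int A \<in> carrier_mat n n"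
    using A(1) by (auto simp: aperiodic_mat_def)
  have char: "eigenvalue (map_mat of_int A) x \<longleftrightarrow> poly (of_int_poly (char_poly A)) x = 0" for x :: complex
    using eigenvalue_root_char_poly[OF A_carrier(2)] of_int_hom.char_poly_hom[OF A_carrier(1)] by metis
  have "poly (of_int_poly (char_poly A)) (complex_of_real q) = 0"
    using spectral_radius_eigenvalue[OF A(1) n] char A(2) by simp
  then have "eigenvalue (map_mat of_int A) z"
    unfolding char using galois_conjugates_root_int[OF q(2) _ z] by blast
  then obtain k k' where k: "k < k'" "k' \<le> n"
    "norm ((z / of_real q) ^ k - (z / of_real q) ^ k') \<le> 2 * sqrt (1 - norm (z / of_real q) ^ (2 * n))"
    using aperiodic_eigenvalue_recurrence[OF A(1) n A(2) q(1)] by blast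
  have "norm (z / of_real q) ^ (2 * N) \<le> norm (z / of_real q) ^ (2 * n)"
    using spiral \<open>n \<le> N\<close> by (intro power_decreasing) (auto simp: spiral_params_def)
  then have "2 * sqrt (1 - norm (z / of_real q) ^ (2 * n)) \<le> 2 * sqrt (1 - norm (z / of_real q) ^ (2 * N))"
    by simp
  also have "\<dots> < norm ((z / of_real q) ^ k - (z / of_real q) ^ k')"
    using spiral k \<open>n \<le> N\<close> by (auto simp: spiral_params_def)
  finally show False using k(3) by simp
qed

lemma eventually_linear_gt:
  fixes c d :: real
  assumes "c > 0"
  shows "eventually (\<lambda>x. d < x * c) at_top"
  using eventually_gt_at_top[of "d / c"] by (rule eventually_mono) (use assms in \<open>simp add: field_simps\<close>)

theorem corollary1p3:
  fixes N :: nat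
  assumes "N > 0"
  shows "\<exists>\<alpha>::real. biPerron \<alpha> \<and> algebraic_degree (of_real \<alpha>) \<le> 6 \<and>
    perron_frobenius_degree \<alpha> > N"
proof -
  obtain \<mu> where \<mu>: "\<mu> \<in> spiral_params N" "Re \<mu> \<in> \<rat>" "Im \<mu> \<in> \<rat>" "Im \<mu> > 0"
    "norm \<mu> ^ (2 * N) < - 2 * Re (\<mu> ^ N)" "- 2 * Re (\<mu> ^ N) < 1"
    using ex_Gaussian_rational_spiral_param[OF assms] by blast
  have \<mu>_norm: "0 < norm \<mu>" "norm \<mu> < 1" using \<mu>(1,4) by (auto simp: spiral_params_def)
  define n where "n = 3 * N"
  have "\<mu> \<noteq> 0" using \<mu>_norm by auto
  then obtain G :: "real poly" and p where G: "\<And>k. coeff G k \<in> \<rat>" "coeff G 0 = 1" "degree G \<le> n - 3"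
    and p: "\<And>j. j < n \<Longrightarrow> p j \<in> \<rat>" "\<And>j. j < n \<Longrightarrow> p j > 0"
    and id: "\<And>y. (1 - y) * (1 - 2 * Re \<mu> * y + (norm \<mu>)\<^sup>2 * y\<^sup>2) * poly G y = 1 - (\<Sum>j<n. p j * y ^ Suc j)"
    using ex_positive_renewal_multiple[OF \<mu>(2,3) _ assms \<mu>(5,6)] unfolding n_def by blast
  obtain \<delta> where \<delta>: "\<delta> > 0" "\<And>x. dist x \<mu> < \<delta> \<Longrightarrow> x \<in> spiral_params N"
    using open_spiral_params \<mu>(1) unfolding open_dist by blast

  have "(norm \<mu>)\<^sup>2 \<in> \<rat>" unfolding cmod_power2 using \<mu> by auto
  then obtain D where D: "D > (0::nat)"
    "\<forall>r\<in>p ` {..<n} \<union> coeff G ` {..<n} \<union> {2 * Re \<mu>, (norm \<mu>)\<^sup>2}. real D * r \<in> \<int>"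
    using common_denominator[of "p ` {..<n} \<union> coeff G ` {..<n} \<union> {2 * Re \<mu>, (norm \<mu>)\<^sup>2}"] G(1) p(1) \<mu>(2) by auto

  have "eventually (\<lambda>x. 1 < x * Im \<mu> \<and> 1 < x * (1 - norm \<mu>) \<and> 4 < x * norm \<mu> \<and>
      8 * norm \<mu> + 1 < x * (norm \<mu>)\<^sup>2 \<and> 7 < x * \<delta> \<and> (\<forall>j\<in>{..<n}. - coeff G (j - 2) < x * p j) \<and> 1 \<le> x) at_top"
    using \<mu> \<mu>_norm \<delta>(1) p(2)
    by (intro eventually_conj eventually_ball_finite ballI eventually_linear_gt eventually_ge_at_top) auto
  then obtain K0 where K0: "\<And>x. x \<ge> K0 \<Longrightarrow> 1 < x * Im \<mu> \<and> 1 < x * (1 - norm \<mu>) \<and> 4 < x * norm \<mu> \<and>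
      8 * norm \<mu> + 1 < x * (norm \<mu>)\<^sup>2 \<and> 7 < x * \<delta> \<and> (\<forall>j\<in>{..<n}. - coeff G (j - 2) < x * p j) \<and> 1 \<le> x"
    unfolding eventually_at_top_linorder by blast
  define k where "k = nat \<lceil>K0\<rceil>"
  define K where "K = int (D * k)"
  have K_D: "real_of_int K = real k * real D" by (simp add: K_def)
  have "K0 \<le> real k" unfolding k_def by linarith
  also have "real k = real k * 1" by simp
  also have "real k * 1 \<le> real k * real D" using D(1) by (intro mult_left_mono) auto
  finally have "K0 \<le> real_of_int K" by (simp add: K_D)
  note K = K0[OF this]
  have K_int: "of_int K * r \<in> \<int>" if "r \<in> p ` {..<n} \<union> coeff G ` {..<n} \<union> {2 * Re \<mu>, (norm \<mu>)\<^sup>2}" for r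
    unfolding K_D mult.assoc by (rule Ints_mult[OF Ints_of_nat]) (use D(2) that in blast)
  obtain T where T: "of_int T = of_int K * (2 * Re \<mu>)" using K_int[of "2 * Re \<mu>"] by (auto elim: Ints_cases)
  have "of_int K * (of_int K * (norm \<mu>)\<^sup>2) \<in> \<int>" by (rule Ints_mult[OF Ints_of_int K_int]) simp
  then obtain M where M: "of_int M = (of_int K)\<^sup>2 * (norm \<mu>)\<^sup>2"
    by (auto elim!: Ints_cases simp: power2_eq_square mult.assoc)
  \<comment> \<open>with \<open>m = \<bar>\<mu>\<bar>\<close>: \<open>(K * m - 4)\<^sup>2 = K * (K * m\<^sup>2 - 8 * m) + 16\<close>\<close>
  have sq: "of_int K + 3 < (of_int K * norm \<mu> - 4)\<^sup>2"
  proof -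
    have "of_int K * 1 \<le> of_int K * (of_int K * (norm \<mu>)\<^sup>2 - 8 * norm \<mu>)"
      using K by (intro mult_left_mono) auto
    then show ?thesis by (simp add: power2_eq_square algebra_simps)
  qed
  obtain b q z where b: "of_int K < b" "b < of_int K + 1" "(b - of_int K) * (b\<^sup>2 - of_int T * b + of_int M) = 1"
    and q: "b + 1 < q" "q < b + 2" "(q - 1)\<^sup>2 = b * q" "biPerron q" "algebraic_degree (of_real q) \<le> 6"
      "algebraic (complex_of_real q)"
    and z: "z \<in> galois_conjugates (of_real q)" "norm (z - of_int K * \<mu>) \<le> 4"
    using biPerron_of_perturbed_cubic[OF T M _ _ _ _ sq] K by auto
  have b_pos: "b > 0" using b K by linarith
  have q_gt: "q > 1" using q b_pos by linarith

  have "\<exists>a :: nat \<Rightarrow> int. (\<forall>j<n. a j > 0) \<and> (\<Sum>j<n. of_int (a j) / b ^ j) = b"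
  proof (rule ex_renewal_coefficients[OF _ G(2) _ id _ b_pos _ _ _ _ p(2)])
    show "(b - of_int K) * (b\<^sup>2 - of_int K * (2 * Re \<mu>) * b + (of_int K)\<^sup>2 * (norm \<mu>)\<^sup>2) = 1"
      using b(3) unfolding T M .
    show "0 < of_int K * p j + coeff G (j - 2)" if "j < n" for j
      using K that by (force dest: bspec[of _ _ j])
  qed (use assms G(3) K K_int in \<open>auto simp: n_def\<close>)
  then obtain a :: "nat \<Rightarrow> int" where a: "\<And>j. j < n \<Longrightarrow> a j > 0" "(\<Sum>j<n. of_int (a j) / b ^ j) = b" by blast
  have mat: "\<exists>A. aperiodic_mat (2 * n) A \<and> spectral_radius (map_mat of_int A) = q"
    using ex_aperiodic_mat_doubled_companion[OF _ a(1) b_pos a(2) q_gt q(3)] assms by (simp add: n_def)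

  \<comment> \<open>both \<open>z - K * \<mu>\<close> and \<open>q - K\<close> are bounded independently of \<open>K\<close>, so \<open>z / q\<close> is near \<open>\<mu>\<close> for large \<open>K\<close>\<close>
  have "norm (of_int K * \<mu> - of_real q * \<mu>) = (q - of_int K) * norm \<mu>"
  proof -
    have "of_int K * \<mu> - of_real q * \<mu> = of_real (of_int K - q) * \<mu>" by (simp add: left_diff_distrib)
    then show ?thesis using q(1) b(1) by (simp only: norm_mult norm_of_real) simp
  qed
  also have "\<dots> \<le> 3 * 1" using q b \<mu>_norm by (intro mult_mono) auto
  finally have "norm (z - of_real q * \<mu>) \<le> 7"
    using z(2) norm_triangle_ineq[of "z - of_int K * \<mu>" "of_int K * \<mu> - of_real q * \<mu>"] by simp
  also have "7 < of_int K * \<delta>" using K by simp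
  also have "\<dots> \<le> q * \<delta>" using q(1) b \<delta>(1) by (intro mult_right_mono) auto
  finally have "norm ((z - of_real q * \<mu>) / of_real q) < \<delta>"
    using q_gt by (simp add: norm_divide field_simps)
  then have "dist (z / of_real q) \<mu> < \<delta>" using q_gt by (simp add: dist_norm diff_divide_distrib)
  then have "perron_frobenius_degree q > N"
    using perron_frobenius_degree_gt[OF mat _ _ q(6) z(1)] \<delta>(2) q_gt assms by (simp add: n_def)
  then show ?thesis using q by blast
qed

end
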